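(* There exist finite, perfect and centrally indecomposable groups $Q_1, Q_2, Q_3$, and a central product $G = Q_1Q_2Q_3$, such that (1) each $Q_i$ is characteristic in $G$; (2) in the group $(G, \circ)$ obtained from $G$ by replacing $Q_1$ with its opposite, the subgroups $Q_1$ and $Q_2$ are exchanged by an automorphism of $(G, \circ)$, and thus are not characteristic in $(G, \circ)$.
   Context: A group is perfect if it equals its derived subgroup. $G$ is a central product of subgroups $Q_1, \dots, Q_m$ if $G = Q_1 \cdots Q_m$ and $[Q_i, Q_j] = 1$ for $i \neq j$. A non-trivial perfect group is centrally indecomposable if it is not a central product of two proper subgroups. The opposite of a group is the group obtained by exchanging the order of factors in its product. If $G = Q_1R$ is a central product (here $R = Q_2Q_3$), the group $(G, \circ)$ obtained from $G$ by replacing $Q_1$ with its opposite is the set $G$ with the (well-defined) group operation $$(xy) \circ (ab) = (ax)(yb), \qquad x, a \in Q_1,\ y, b \in R;$$ the subsets $Q_i$ are also subgroups of $(G,\circ)$. *)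

theory Defs
  imports "HOL-Algebra.Algebra"
begin

definition commutator_subgroup :: "('a, 'b) monoid_scheme \<Rightarrow> 'a set \<Rightarrow> 'a set \<Rightarrow> 'a set" where
  "commutator_subgroup G H K =
     generate G (\<Union>h \<in> H. \<Union>k \<in> K. {h \<otimes>\<^bsub>G\<^esub> k \<otimes>\<^bsub>G\<^esub> inv\<^bsub>G\<^esub> h \<otimes>\<^bsub>G\<^esub> inv\<^bsub>G\<^esub> k})"

definition perfect_group :: "('a, 'b) monoid_scheme \<Rightarrow> bool" where
  "perfect_group G \<longleftrightarrow> group G \<and> derived G (carrier G) = carrier G"

definition central_product :: "('a, 'b) monoid_scheme \<Rightarrow> 'a set list \<Rightarrow> bool" where
  "central_product G Qs \<longleftrightarrow>
     group G \<and>
     (\<forall>Q \<in> set Qs. subgroup Q G) \<and>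
     carrier G = foldr (\<lambda>H K. H <#>\<^bsub>G\<^esub> K) Qs {\<one>\<^bsub>G\<^esub>} \<and>
     (\<forall>i < length Qs. \<forall>j < length Qs. i \<noteq> j \<longrightarrow>
        commutator_subgroup G (Qs ! i) (Qs ! j) = {\<one>\<^bsub>G\<^esub>})"

definition centrally_indecomposable :: "('a, 'b) monoid_scheme \<Rightarrow> bool" where
  "centrally_indecomposable G \<longleftrightarrow>
     perfect_group G \<and> carrier G \<noteq> {\<one>\<^bsub>G\<^esub>} \<and>
     \<not> (\<exists>H K. H \<subset> carrier G \<and> K \<subset> carrier G \<and> central_product G [H, K])"

definition characteristic_subgroup :: "'a set \<Rightarrow> ('a, 'b) monoid_scheme \<Rightarrow> bool" where
  "characteristic_subgroup H G \<longleftrightarrow> subgroup H G \<and> (\<forall>\<phi> \<in> auto G. \<phi> ` H = H)"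

text \<open>
  If \<open>G\<close> is the central product of \<open>Q\<close> and \<open>R\<close>, this is the group obtained from \<open>G\<close> by replacing
  \<open>Q\<close> with its opposite. The description below determines \<open>z\<close> uniquely only in that case, see
  \<open>replace_by_opposite_mult\<close>. Carrier and neutral element are those of \<open>G\<close>.
\<close>

definition replace_by_opposite ::
    "('a, 'b) monoid_scheme \<Rightarrow> 'a set \<Rightarrow> 'a set \<Rightarrow> ('a, 'b) monoid_scheme" where
  "replace_by_opposite G Q R = G\<lparr>mult := (\<lambda>g h. THE z.
     \<exists>x \<in> Q. \<exists>y \<in> R. \<exists>a \<in> Q. \<exists>b \<in> R.
       g = x \<otimes>\<^bsub>G\<^esub> y \<and> h = a \<otimes>\<^bsub>G\<^esub> b \<and> z = (a \<otimes>\<^bsub>G\<^esub> x) \<otimes>\<^bsub>G\<^esub> (y \<otimes>\<^bsub>G\<^esub> b))\<rparr>"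

lemma commutator_subgroup_trivial_iff:
  assumes "group G" "H \<subseteq> carrier G" "K \<subseteq> carrier G"
  shows "commutator_subgroup G H K = {\<one>\<^bsub>G\<^esub>} \<longleftrightarrow> (\<forall>h \<in> H. \<forall>k \<in> K. h \<otimes>\<^bsub>G\<^esub> k = k \<otimes>\<^bsub>G\<^esub> h)"
proof -
  interpret group G by fact
  let ?S = "\<Union>h \<in> H. \<Union>k \<in> K. {h \<otimes>\<^bsub>G\<^esub> k \<otimes>\<^bsub>G\<^esub> inv\<^bsub>G\<^esub> h \<otimes>\<^bsub>G\<^esub> inv\<^bsub>G\<^esub> k}"
  have comm: "h \<otimes>\<^bsub>G\<^esub> k \<otimes>\<^bsub>G\<^esub> inv\<^bsub>G\<^esub> h \<otimes>\<^bsub>G\<^esub> inv\<^bsub>G\<^esub> k = \<one>\<^bsub>G\<^esub> \<longleftrightarrow> h \<otimes>\<^bsub>G\<^esub> k = k \<otimes>\<^bsub>G\<^esub> h"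
    if "h \<in> carrier G" "k \<in> carrier G" for h k
  proof -
    have "h \<otimes>\<^bsub>G\<^esub> k \<otimes>\<^bsub>G\<^esub> inv\<^bsub>G\<^esub> h \<otimes>\<^bsub>G\<^esub> inv\<^bsub>G\<^esub> k = (h \<otimes>\<^bsub>G\<^esub> k) \<otimes>\<^bsub>G\<^esub> inv\<^bsub>G\<^esub> (k \<otimes>\<^bsub>G\<^esub> h)"
      using that by (simp add: inv_mult_group m_assoc)
    then show ?thesis
      using that by (metis inv_closed inv_equality inv_inv m_closed r_inv)
  qed
  show ?thesis
  proof
    assume "commutator_subgroup G H K = {\<one>\<^bsub>G\<^esub>}"
    then have "?S \<subseteq> {\<one>\<^bsub>G\<^esub>}"
      unfolding commutator_subgroup_def using generate.incl[of _ ?S G] by blast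
    then show "\<forall>h \<in> H. \<forall>k \<in> K. h \<otimes>\<^bsub>G\<^esub> k = k \<otimes>\<^bsub>G\<^esub> h"
      using comm assms by blast
  next
    assume "\<forall>h \<in> H. \<forall>k \<in> K. h \<otimes>\<^bsub>G\<^esub> k = k \<otimes>\<^bsub>G\<^esub> h"
    then have "?S \<subseteq> {\<one>\<^bsub>G\<^esub>}"
      using comm assms by blast
    then have "generate G ?S \<subseteq> {\<one>\<^bsub>G\<^esub>}"
      by (intro generate_subgroup_incl triv_subgroup)
    then show "commutator_subgroup G H K = {\<one>\<^bsub>G\<^esub>}"
      unfolding commutator_subgroup_def using generate.one by blast
  qed
qed

lemma central_product_pair_iff:
  "central_product G [Q, R] \<longleftrightarrow>
     group G \<and> subgroup Q G \<and> subgroup R G \<and> carrier G = Q <#>\<^bsub>G\<^esub> R \<and>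
     (\<forall>x \<in> Q. \<forall>y \<in> R. x \<otimes>\<^bsub>G\<^esub> y = y \<otimes>\<^bsub>G\<^esub> x)"
proof (cases "group G \<and> subgroup Q G \<and> subgroup R G")
  case True
  then interpret group G by simp
  have sub: "Q \<subseteq> carrier G" "R \<subseteq> carrier G"
    using True subgroup.subset by auto
  then have one: "R <#>\<^bsub>G\<^esub> {\<one>\<^bsub>G\<^esub>} = R"
    unfolding set_mult_def by (auto simp: subset_iff)
  have "(\<forall>i < length [Q, R]. \<forall>j < length [Q, R]. i \<noteq> j \<longrightarrow>
          commutator_subgroup G ([Q, R] ! i) ([Q, R] ! j) = {\<one>\<^bsub>G\<^esub>}) \<longleftrightarrow>
        commutator_subgroup G Q R = {\<one>\<^bsub>G\<^esub>} \<and> commutator_subgroup G R Q = {\<one>\<^bsub>G\<^esub>}"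
    by (auto simp: less_Suc_eq)
  also have "\<dots> \<longleftrightarrow> (\<forall>x \<in> Q. \<forall>y \<in> R. x \<otimes>\<^bsub>G\<^esub> y = y \<otimes>\<^bsub>G\<^esub> x)"
    unfolding commutator_subgroup_trivial_iff[OF is_group sub(1) sub(2)]
      commutator_subgroup_trivial_iff[OF is_group sub(2) sub(1)] by metis
  finally show ?thesis
    unfolding central_product_def using True one by auto
next
  case False
  then show ?thesis
    unfolding central_product_def by auto
qed

lemma central_product_triple_imp_pair:
  assumes "central_product G [Q1, Q2, Q3]"
  shows "central_product G [Q1, Q2 <#>\<^bsub>G\<^esub> Q3]"
proof -
  interpret group G using assms unfolding central_product_def by simp
  have subg: "subgroup Q1 G" "subgroup Q2 G" "subgroup Q3 G"
    using assms unfolding central_product_def by auto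
  have sub: "Q1 \<subseteq> carrier G" "Q2 \<subseteq> carrier G" "Q3 \<subseteq> carrier G"
    using subg subgroup.subset by auto
  have C: "\<And>i j. \<lbrakk>i < 3; j < 3; i \<noteq> j\<rbrakk> \<Longrightarrow>
      commutator_subgroup G ([Q1, Q2, Q3] ! i) ([Q1, Q2, Q3] ! j) = {\<one>\<^bsub>G\<^esub>}"
    using assms unfolding central_product_def by (simp add: numeral_3_eq_3)
  have c: "\<forall>x \<in> Q1. \<forall>y \<in> Q2. x \<otimes>\<^bsub>G\<^esub> y = y \<otimes>\<^bsub>G\<^esub> x"
          "\<forall>x \<in> Q1. \<forall>y \<in> Q3. x \<otimes>\<^bsub>G\<^esub> y = y \<otimes>\<^bsub>G\<^esub> x"
          "\<forall>x \<in> Q2. \<forall>y \<in> Q3. x \<otimes>\<^bsub>G\<^esub> y = y \<otimes>\<^bsub>G\<^esub> x"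
    using C[of 0 1] C[of 0 2] C[of 1 2]
    by (simp_all add: commutator_subgroup_trivial_iff[OF is_group] sub)
  have "Q3 <#>\<^bsub>G\<^esub> {\<one>\<^bsub>G\<^esub>} = Q3"
    using sub unfolding set_mult_def by (auto simp: subset_iff)
  then have carr: "carrier G = Q1 <#>\<^bsub>G\<^esub> (Q2 <#>\<^bsub>G\<^esub> Q3)"
    using assms unfolding central_product_def by simp
  have R: "subgroup (Q2 <#>\<^bsub>G\<^esub> Q3) G"
  proof (rule subgroupI)
    show "Q2 <#>\<^bsub>G\<^esub> Q3 \<subseteq> carrier G"
      using sub setmult_subset_G by blast
    show "Q2 <#>\<^bsub>G\<^esub> Q3 \<noteq> {}"
      using subg subgroup.one_closed unfolding set_mult_def by blast
  next
    fix g assume "g \<in> Q2 <#>\<^bsub>G\<^esub> Q3"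
    then obtain u v where uv: "u \<in> Q2" "v \<in> Q3" "g = u \<otimes>\<^bsub>G\<^esub> v"
      unfolding set_mult_def by auto
    then have i: "inv\<^bsub>G\<^esub> u \<in> Q2" "inv\<^bsub>G\<^esub> v \<in> Q3"
      using subg subgroup.m_inv_closed by metis+
    have "inv\<^bsub>G\<^esub> g = inv\<^bsub>G\<^esub> v \<otimes>\<^bsub>G\<^esub> inv\<^bsub>G\<^esub> u"
      using uv sub by (simp add: inv_mult_group subset_iff)
    also have "\<dots> = inv\<^bsub>G\<^esub> u \<otimes>\<^bsub>G\<^esub> inv\<^bsub>G\<^esub> v"
      using c(3) i by metis
    finally show "inv\<^bsub>G\<^esub> g \<in> Q2 <#>\<^bsub>G\<^esub> Q3"
      using i unfolding set_mult_def by blast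
  next
    fix g h assume "g \<in> Q2 <#>\<^bsub>G\<^esub> Q3" "h \<in> Q2 <#>\<^bsub>G\<^esub> Q3"
    then obtain u v s t where m: "u \<in> Q2" "v \<in> Q3" "g = u \<otimes>\<^bsub>G\<^esub> v" "s \<in> Q2" "t \<in> Q3" "h = s \<otimes>\<^bsub>G\<^esub> t"
      unfolding set_mult_def by auto
    then have carr: "u \<in> carrier G" "v \<in> carrier G" "s \<in> carrier G" "t \<in> carrier G"
      using sub by auto
    have "s \<otimes>\<^bsub>G\<^esub> v = v \<otimes>\<^bsub>G\<^esub> s"
      using c(3) m by blast
    then have "g \<otimes>\<^bsub>G\<^esub> h = (u \<otimes>\<^bsub>G\<^esub> s) \<otimes>\<^bsub>G\<^esub> (v \<otimes>\<^bsub>G\<^esub> t)"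
      unfolding m using carr by (metis m_assoc m_closed)
    moreover have "u \<otimes>\<^bsub>G\<^esub> s \<in> Q2" "v \<otimes>\<^bsub>G\<^esub> t \<in> Q3"
      using m subg subgroup.m_closed by metis+
    ultimately show "g \<otimes>\<^bsub>G\<^esub> h \<in> Q2 <#>\<^bsub>G\<^esub> Q3"
      unfolding set_mult_def by blast
  qed
  have "x \<otimes>\<^bsub>G\<^esub> y = y \<otimes>\<^bsub>G\<^esub> x" if x: "x \<in> Q1" and "y \<in> Q2 <#>\<^bsub>G\<^esub> Q3" for x y
  proof -
    obtain u v where uv: "u \<in> Q2" "v \<in> Q3" "y = u \<otimes>\<^bsub>G\<^esub> v"
      using \<open>y \<in> _\<close> unfolding set_mult_def by auto
    have mem: "x \<in> carrier G" "u \<in> carrier G" "v \<in> carrier G"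
      using x uv sub by auto
    have "x \<otimes>\<^bsub>G\<^esub> u = u \<otimes>\<^bsub>G\<^esub> x" "x \<otimes>\<^bsub>G\<^esub> v = v \<otimes>\<^bsub>G\<^esub> x"
      using c x uv by auto
    then show ?thesis
      using mem uv(3) by (metis m_assoc)
  qed
  then show ?thesis
    unfolding central_product_pair_iff using R carr subg(1) is_group by blast
qed

lemma replace_by_opposite_simps [simp]:
  "carrier (replace_by_opposite G Q R) = carrier G"
  "one (replace_by_opposite G Q R) = one G"
  by (simp_all add: replace_by_opposite_def)

lemma replace_by_opposite_mult:
  assumes cp: "central_product G [Q, R]"
    and mem: "x \<in> Q" "a \<in> Q" "y \<in> R" "b \<in> R"
  shows "(x \<otimes>\<^bsub>G\<^esub> y) \<otimes>\<^bsub>replace_by_opposite G Q R\<^esub> (a \<otimes>\<^bsub>G\<^esub> b) = (a \<otimes>\<^bsub>G\<^esub> x) \<otimes>\<^bsub>G\<^esub> (y \<otimes>\<^bsub>G\<^esub> b)"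
proof -
  interpret group G using cp unfolding central_product_def by simp
  have Q: "subgroup Q G" and R: "subgroup R G"
    and c: "\<And>x y. x \<in> Q \<Longrightarrow> y \<in> R \<Longrightarrow> x \<otimes>\<^bsub>G\<^esub> y = y \<otimes>\<^bsub>G\<^esub> x"
    using cp unfolding central_product_pair_iff by auto
  have sub: "\<And>x. x \<in> Q \<Longrightarrow> x \<in> carrier G" "\<And>x. x \<in> R \<Longrightarrow> x \<in> carrier G"
    using Q R subgroup.mem_carrier by metis+
  have split: "\<exists>z. z \<in> Q \<and> z \<in> R \<and> x = x' \<otimes>\<^bsub>G\<^esub> z \<and> y' = z \<otimes>\<^bsub>G\<^esub> y"
    if m: "x \<in> Q" "x' \<in> Q" "y \<in> R" "y' \<in> R" and e: "x \<otimes>\<^bsub>G\<^esub> y = x' \<otimes>\<^bsub>G\<^esub> y'" for x x' y y'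
  proof -
    have carr: "x \<in> carrier G" "x' \<in> carrier G" "y \<in> carrier G" "y' \<in> carrier G"
      using m sub by auto
    define z where "z = inv\<^bsub>G\<^esub> x' \<otimes>\<^bsub>G\<^esub> x"
    have z: "z \<in> carrier G" "z \<in> Q"
      using carr m Q by (auto simp: z_def subgroup.m_closed subgroup.m_inv_closed)
    have x: "x = x' \<otimes>\<^bsub>G\<^esub> z"
      using carr by (simp add: z_def m_assoc[symmetric])
    have y: "y' = z \<otimes>\<^bsub>G\<^esub> y"
      using e carr z unfolding x by (simp add: m_assoc)
    have "z = y' \<otimes>\<^bsub>G\<^esub> inv\<^bsub>G\<^esub> y"
      using carr z unfolding y by (simp add: m_assoc)
    then have "z \<in> R"
      using m R by (simp add: subgroup.m_closed subgroup.m_inv_closed)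
    then show ?thesis using z x y by blast
  qed
  have uniq: "(a' \<otimes>\<^bsub>G\<^esub> x') \<otimes>\<^bsub>G\<^esub> (y' \<otimes>\<^bsub>G\<^esub> b') = (a \<otimes>\<^bsub>G\<^esub> x) \<otimes>\<^bsub>G\<^esub> (y \<otimes>\<^bsub>G\<^esub> b)"
    if m: "x' \<in> Q" "a' \<in> Q" "y' \<in> R" "b' \<in> R"
      and e: "x \<otimes>\<^bsub>G\<^esub> y = x' \<otimes>\<^bsub>G\<^esub> y'" "a \<otimes>\<^bsub>G\<^esub> b = a' \<otimes>\<^bsub>G\<^esub> b'" for x' a' y' b'
  proof -
    obtain z where z: "z \<in> Q" "z \<in> R" "x = x' \<otimes>\<^bsub>G\<^esub> z" "y' = z \<otimes>\<^bsub>G\<^esub> y"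
      using split[of x x' y y'] mem m e by blast
    obtain w where w: "w \<in> Q" "w \<in> R" "a = a' \<otimes>\<^bsub>G\<^esub> w" "b' = w \<otimes>\<^bsub>G\<^esub> b"
      using split[of a a' b b'] mem m e by blast
    have carr: "a' \<in> carrier G" "x' \<in> carrier G" "y \<in> carrier G" "b \<in> carrier G"
      "z \<in> carrier G" "w \<in> carrier G"
      using mem m z w sub by auto
    have "w \<otimes>\<^bsub>G\<^esub> (x' \<otimes>\<^bsub>G\<^esub> (z \<otimes>\<^bsub>G\<^esub> (y \<otimes>\<^bsub>G\<^esub> b))) = x' \<otimes>\<^bsub>G\<^esub> (w \<otimes>\<^bsub>G\<^esub> (z \<otimes>\<^bsub>G\<^esub> (y \<otimes>\<^bsub>G\<^esub> b)))"
      using c[of x' w] carr m w by (simp flip: m_assoc)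
    also have "w \<otimes>\<^bsub>G\<^esub> (z \<otimes>\<^bsub>G\<^esub> (y \<otimes>\<^bsub>G\<^esub> b)) = z \<otimes>\<^bsub>G\<^esub> (w \<otimes>\<^bsub>G\<^esub> (y \<otimes>\<^bsub>G\<^esub> b))"
      using c[of w z] carr z w by (simp flip: m_assoc)
    also have "w \<otimes>\<^bsub>G\<^esub> (y \<otimes>\<^bsub>G\<^esub> b) = y \<otimes>\<^bsub>G\<^esub> (w \<otimes>\<^bsub>G\<^esub> b)"
      using c[of w y] carr mem w by (simp flip: m_assoc)
    finally show ?thesis
      using carr unfolding z(3,4) w(3,4) by (simp add: m_assoc)
  qed
  have "(THE z. \<exists>x' \<in> Q. \<exists>y' \<in> R. \<exists>a' \<in> Q. \<exists>b' \<in> R.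
       x \<otimes>\<^bsub>G\<^esub> y = x' \<otimes>\<^bsub>G\<^esub> y' \<and> a \<otimes>\<^bsub>G\<^esub> b = a' \<otimes>\<^bsub>G\<^esub> b' \<and>
       z = (a' \<otimes>\<^bsub>G\<^esub> x') \<otimes>\<^bsub>G\<^esub> (y' \<otimes>\<^bsub>G\<^esub> b')) = (a \<otimes>\<^bsub>G\<^esub> x) \<otimes>\<^bsub>G\<^esub> (y \<otimes>\<^bsub>G\<^esub> b)"
    by (rule the_equality) (use mem uniq in blast)+
  then show ?thesis
    by (simp add: replace_by_opposite_def)
qed

lemma replace_by_opposite_group:
  assumes cp: "central_product G [Q, R]"
  shows "group (replace_by_opposite G Q R)"
    and "subgroup H G \<Longrightarrow> H \<subseteq> Q \<or> H \<subseteq> R \<Longrightarrow> subgroup H (replace_by_opposite G Q R)"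
    and "x \<in> Q \<Longrightarrow> a \<in> Q \<Longrightarrow> x \<otimes>\<^bsub>replace_by_opposite G Q R\<^esub> a = a \<otimes>\<^bsub>G\<^esub> x"
    and "y \<in> R \<Longrightarrow> b \<in> R \<Longrightarrow> y \<otimes>\<^bsub>replace_by_opposite G Q R\<^esub> b = y \<otimes>\<^bsub>G\<^esub> b"
proof -
  interpret group G using cp unfolding central_product_def by simp
  let ?G = "replace_by_opposite G Q R"
  note mult = replace_by_opposite_mult[OF cp]
  have Q: "subgroup Q G" and R: "subgroup R G" and GQR: "carrier G = Q <#>\<^bsub>G\<^esub> R"
    using cp unfolding central_product_pair_iff by auto
  have sub: "\<And>x. x \<in> Q \<Longrightarrow> x \<in> carrier G" "\<And>x. x \<in> R \<Longrightarrow> x \<in> carrier G"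
    using Q R subgroup.mem_carrier by metis+
  note cl = subgroup.m_closed[OF Q] subgroup.m_closed[OF R]
    subgroup.m_inv_closed[OF Q] subgroup.m_inv_closed[OF R]
    subgroup.one_closed[OF Q] subgroup.one_closed[OF R]
  have dec: "\<exists>x \<in> Q. \<exists>y \<in> R. g = x \<otimes>\<^bsub>G\<^esub> y" if "g \<in> carrier G" for g
    using that unfolding GQR set_mult_def by auto
  show multQ: "x \<otimes>\<^bsub>?G\<^esub> a = a \<otimes>\<^bsub>G\<^esub> x" if "x \<in> Q" "a \<in> Q" for x a
    using mult[OF that cl(6) cl(6)] that sub by simp
  show multR: "y \<otimes>\<^bsub>?G\<^esub> b = y \<otimes>\<^bsub>G\<^esub> b" if "y \<in> R" "b \<in> R" for y b
    using mult[OF cl(5) cl(5) that] that sub by simp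
  show grp: "group ?G"
  proof (rule groupI)
    fix g h assume "g \<in> carrier ?G" "h \<in> carrier ?G"
    then obtain x y a b where "x \<in> Q" "y \<in> R" "g = x \<otimes>\<^bsub>G\<^esub> y" "a \<in> Q" "b \<in> R" "h = a \<otimes>\<^bsub>G\<^esub> b"
      using dec by (metis replace_by_opposite_simps(1))
    then show "g \<otimes>\<^bsub>?G\<^esub> h \<in> carrier ?G"
      using sub by (simp add: mult)
  next
    show "\<one>\<^bsub>?G\<^esub> \<in> carrier ?G" by simp
  next
    fix g h k assume "g \<in> carrier ?G" "h \<in> carrier ?G" "k \<in> carrier ?G"
    then obtain x y a b u v where
      "x \<in> Q" "y \<in> R" "g = x \<otimes>\<^bsub>G\<^esub> y" "a \<in> Q" "b \<in> R" "h = a \<otimes>\<^bsub>G\<^esub> b"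
      "u \<in> Q" "v \<in> R" "k = u \<otimes>\<^bsub>G\<^esub> v"
      using dec by (metis replace_by_opposite_simps(1))
    then show "g \<otimes>\<^bsub>?G\<^esub> h \<otimes>\<^bsub>?G\<^esub> k = g \<otimes>\<^bsub>?G\<^esub> (h \<otimes>\<^bsub>?G\<^esub> k)"
      using sub by (simp add: mult cl) (simp add: m_assoc)
  next
    fix g assume g: "g \<in> carrier ?G"
    then obtain x y where xy: "x \<in> Q" "y \<in> R" "g = x \<otimes>\<^bsub>G\<^esub> y"
      using dec by (metis replace_by_opposite_simps(1))
    show "\<one>\<^bsub>?G\<^esub> \<otimes>\<^bsub>?G\<^esub> g = g"
      using mult[OF cl(5) xy(1) cl(6) xy(2)] xy sub by simp
    have "(inv\<^bsub>G\<^esub> x \<otimes>\<^bsub>G\<^esub> inv\<^bsub>G\<^esub> y) \<otimes>\<^bsub>?G\<^esub> g = \<one>\<^bsub>G\<^esub>"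
      using mult[OF cl(3)[OF xy(1)] xy(1) cl(4)[OF xy(2)] xy(2)] xy sub by simp
    then show "\<exists>h \<in> carrier ?G. h \<otimes>\<^bsub>?G\<^esub> g = \<one>\<^bsub>?G\<^esub>"
      using xy sub by (metis inv_closed m_closed replace_by_opposite_simps)
  qed
  show "subgroup H ?G" if H: "subgroup H G" "H \<subseteq> Q \<or> H \<subseteq> R"
  proof -
    interpret O: group ?G by (fact grp)
    have Hc: "\<And>h. h \<in> H \<Longrightarrow> h \<in> carrier G"
      using H(1) by (rule subgroup.mem_carrier)
    have multH: "g \<otimes>\<^bsub>?G\<^esub> h \<in> H" if "g \<in> H" "h \<in> H" for g h
      using H that multQ multR by (metis subgroup.m_closed subsetD)
    have invH: "inv\<^bsub>?G\<^esub> h = inv\<^bsub>G\<^esub> h" if h: "h \<in> H" for h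
    proof -
      have "inv\<^bsub>G\<^esub> h \<otimes>\<^bsub>?G\<^esub> h = \<one>\<^bsub>?G\<^esub>"
        using H h multQ[of "inv\<^bsub>G\<^esub> h" h] multR[of "inv\<^bsub>G\<^esub> h" h] Hc
        by (metis l_inv r_inv replace_by_opposite_simps(2) subgroup.m_inv_closed subsetD)
      then show ?thesis
        using h Hc by (intro O.inv_equality) auto
    qed
    show ?thesis
    proof (rule O.subgroupI)
      show "H \<subseteq> carrier ?G" using Hc by auto
      show "H \<noteq> {}" using H(1) subgroup.one_closed by blast
    qed (use multH invH H(1) subgroup.m_inv_closed in \<open>auto\<close>)
  qed
qed

end

theory Submission
  imports Defs "HOL-Library.Product_Plus"
begin

text \<open>
  Let \<open>S = SL(2,5)\<close>, embedded in \<open>SL(2,11)\<close>, act on the extraspecial group \<open>E\<close> of order 1331 and exponent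
  11, and let \<open>H\<close> be the semidirect product of \<open>E\<close> and \<open>S\<close>. An automorphism of \<open>H\<close> induces on \<open>E / Z(E)\<close> a
  matrix that normalizes \<open>S\<close>, and it acts on \<open>Z(H) = Z(E)\<close> as multiplication by the determinant of this
  matrix. The normalizer of \<open>S\<close> in \<open>GL(2,11)\<close> is generated by \<open>S\<close> and the scalars, so the determinant is a
  square modulo 11, whereas \<open>-1\<close> is not.

  Amalgamate the centers of \<open>Q1 = H\<close>, of a copy \<open>Q2\<close> of \<open>H\<close> in which the commutator form has the opposite sign,
  and of a larger group \<open>Q3\<close>, which is \<open>H\<close> with a further natural module for \<open>S\<close> attached. Since the
  factors are perfect and centrally indecomposable, an automorphism of the central product permutes them.
  It fixes \<open>Q3\<close>, the largest one, hence acts on the center as a square, whereas exchanging \<open>Q1\<close> and \<open>Q2\<close>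
  would require a non-square. Replacing \<open>Q1\<close> by its opposite changes the sign of its commutator form, so
  that \<open>Q1\<close> and \<open>Q2\<close> enter symmetrically.
\<close>

section \<open>Perfect groups and central products\<close>

lemma (in group) mult_interchange:
  assumes "b \<otimes> c = c \<otimes> b" "a \<in> carrier G" "b \<in> carrier G" "c \<in> carrier G" "d \<in> carrier G"
  shows "(a \<otimes> b) \<otimes> (c \<otimes> d) = (a \<otimes> c) \<otimes> (b \<otimes> d)"
proof -
  have "(a \<otimes> b) \<otimes> (c \<otimes> d) = a \<otimes> (b \<otimes> c) \<otimes> d"
    using assms(2-) by (simp only: m_assoc m_closed)
  also note assms(1)
  also have "a \<otimes> (c \<otimes> b) \<otimes> d = (a \<otimes> c) \<otimes> (b \<otimes> d)"
    using assms(2-) by (simp only: m_assoc m_closed)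
  finally show ?thesis .
qed

lemma (in group) commutator_in_derived:
  "x \<in> carrier G \<Longrightarrow> y \<in> carrier G \<Longrightarrow> x \<otimes> y \<otimes> inv x \<otimes> inv y \<in> derived G (carrier G)"
  unfolding derived_def by (rule generate.incl) blast

text \<open>Central elements drop out of commutators, so every commutator of the whole group already
  lies in \<open>H\<close>; by perfectness these commutators generate everything.\<close>

lemma (in group) perfect_central_factor:
  assumes perf: "derived G (carrier G) = carrier G"
    and H: "subgroup H G" and G: "carrier G = H <#> K" and K: "K \<subseteq> carrier G"
    and central: "\<And>k x. k \<in> K \<Longrightarrow> x \<in> carrier G \<Longrightarrow> k \<otimes> x = x \<otimes> k"
  shows "H = carrier G"
proof -
  interpret H: subgroup H G by (rule H)
  have cancel: "(a \<otimes> z) \<otimes> inv (d \<otimes> z) = a \<otimes> inv d"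
    if "a \<in> carrier G" "d \<in> carrier G" "z \<in> carrier G" for a d z
  proof -
    have "(a \<otimes> z) \<otimes> inv (d \<otimes> z) = a \<otimes> (z \<otimes> inv z) \<otimes> inv d"
      using that by (simp only: inv_mult_group m_assoc m_closed inv_closed)
    then show ?thesis using that by simp
  qed
  have "x \<otimes> y \<otimes> inv x \<otimes> inv y \<in> H" if x: "x \<in> carrier G" and y: "y \<in> carrier G" for x y
  proof -
    obtain h k where hk: "h \<in> H" "k \<in> K" "x = h \<otimes> k" using x G by (auto simp: set_mult_def)
    obtain h' k' where hk': "h' \<in> H" "k' \<in> K" "y = h' \<otimes> k'" using y G by (auto simp: set_mult_def)
    have c: "h \<in> carrier G" "h' \<in> carrier G" "k \<in> carrier G" "k' \<in> carrier G"
      using hk hk' K by auto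
    have k: "k \<otimes> z = z \<otimes> k" "k' \<otimes> z = z \<otimes> k'" if "z \<in> carrier G" for z
      using central hk hk' that by auto
    have xy: "x \<otimes> y = (h \<otimes> h') \<otimes> (k \<otimes> k')"
      unfolding hk hk' using c k(1)[of h'] by (metis m_assoc m_closed)
    have yx: "y \<otimes> x = (h' \<otimes> h) \<otimes> (k \<otimes> k')"
      unfolding hk hk' using c k(2)[of h] k(2)[of k] by (metis m_assoc m_closed)
    have "x \<otimes> y \<otimes> inv x \<otimes> inv y = (x \<otimes> y) \<otimes> inv (y \<otimes> x)"
      using x y by (simp add: inv_mult_group m_assoc)
    also have "\<dots> = (h \<otimes> h') \<otimes> inv (h' \<otimes> h)"
      unfolding xy yx by (rule cancel) (use c in simp_all)
    also have "\<dots> \<in> H" using hk hk' by simp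
    finally show ?thesis .
  qed
  then have "derived G (carrier G) \<subseteq> H"
    unfolding derived_def by (intro generate_subgroup_incl H) auto
  then show ?thesis using perf H.subset by blast
qed

lemma set_mult_commute:
  assumes "\<And>h k. h \<in> H \<Longrightarrow> k \<in> K \<Longrightarrow> h \<otimes>\<^bsub>G\<^esub> k = k \<otimes>\<^bsub>G\<^esub> h"
  shows "H <#>\<^bsub>G\<^esub> K = K <#>\<^bsub>G\<^esub> H"
  unfolding set_mult_def using assms by force

section \<open>Invariance of perfectness and indecomposability under isomorphism\<close>

lemma iso_perfect_group:
  assumes f: "f \<in> iso A B" and A: "perfect_group A" and B: "group B"
  shows "perfect_group B"
proof -
  interpret A: group A using A by (simp add: perfect_group_def)
  interpret B: group B by (rule B)
  interpret group_hom A B f by unfold_locales (use f in \<open>simp add: iso_def\<close>)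
  have img: "f ` carrier A = carrier B" using f by (auto simp: iso_def bij_betw_def)
  have D: "derived A (carrier A) = carrier A" using A by (simp add: perfect_group_def)
  have "derived B (carrier B) = carrier B"
    using derived_img[of "carrier A"] unfolding D img by simp
  then show ?thesis
    unfolding perfect_group_def using B by blast
qed

lemma iso_centrally_indecomposable:
  assumes f: "f \<in> iso A B" and A: "centrally_indecomposable A" and B: "group B"
  shows "centrally_indecomposable B"
proof -
  have pA: "perfect_group A" using A by (simp add: centrally_indecomposable_def)
  interpret A: group A using pA by (simp add: perfect_group_def)
  interpret B: group B by (rule B)
  define g where "g = inv_into (carrier A) f"
  have g: "g \<in> iso B A" unfolding g_def by (rule A.iso_set_sym[OF f])
  have bij: "bij_betw g (carrier B) (carrier A)" using g by (simp add: iso_def)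
  interpret group_hom B A g by unfold_locales (use g in \<open>simp add: iso_def\<close>)
  have "carrier B \<noteq> {\<one>\<^bsub>B\<^esub>}"
    using A bij hom_one unfolding centrally_indecomposable_def bij_betw_def by force
  moreover have False if HK: "H \<subset> carrier B" "K \<subset> carrier B" "central_product B [H, K]" for H K
  proof -
    have cp: "subgroup H B" "subgroup K B" "carrier B = H <#>\<^bsub>B\<^esub> K"
      "\<And>x y. x \<in> H \<Longrightarrow> y \<in> K \<Longrightarrow> x \<otimes>\<^bsub>B\<^esub> y = y \<otimes>\<^bsub>B\<^esub> x"
      using HK(3) unfolding central_product_pair_iff by blast+
    have sub: "H \<subseteq> carrier B" "K \<subseteq> carrier B" using HK by auto
    have proper: "g ` S \<subset> carrier A" if "S \<subset> carrier B" for S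
      using that bij unfolding bij_betw_def by (metis inj_on_image_eq_iff image_mono psubset_eq subset_refl)
    have "carrier A = g ` (H <#>\<^bsub>B\<^esub> K)" using bij cp(3) by (simp add: bij_betw_def)
    also have "\<dots> = g ` H <#>\<^bsub>A\<^esub> g ` K"
      by (rule set_mult_hom[OF _ sub]) (use g in \<open>simp add: iso_def\<close>)
    finally have AHK: "carrier A = g ` H <#>\<^bsub>A\<^esub> g ` K" .
    have "central_product A [g ` H, g ` K]"
      unfolding central_product_pair_iff
    proof (intro conjI ballI)
      show "group A" by (rule A.is_group)
      show "subgroup (g ` H) A" "subgroup (g ` K) A"
        by (rule subgroup_img_is_subgroup, rule cp)+
      show "carrier A = g ` H <#>\<^bsub>A\<^esub> g ` K" by (rule AHK)
      fix x y assume xy: "x \<in> g ` H" "y \<in> g ` K"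
      obtain h k where hk: "h \<in> H" "k \<in> K" "x = g h" "y = g k" using xy by blast
      then have c: "h \<in> carrier B" "k \<in> carrier B" using sub by blast+
      show "x \<otimes>\<^bsub>A\<^esub> y = y \<otimes>\<^bsub>A\<^esub> x"
        unfolding hk(3,4) hom_mult[OF c, symmetric] hom_mult[OF c(2,1), symmetric]
        by (simp only: cp(4)[OF hk(1,2)])
    qed
    then show False
      using A proper[OF HK(1)] proper[OF HK(2)] unfolding centrally_indecomposable_def by blast
  qed
  ultimately show ?thesis
    unfolding centrally_indecomposable_def using iso_perfect_group[OF f pA B] by blast
qed

lemma hom_iso_image:
  "f \<in> hom A G \<Longrightarrow> inj_on f (carrier A) \<Longrightarrow> f \<in> iso A (G\<lparr>carrier := f ` carrier A\<rparr>)"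
  by (auto simp: iso_def hom_def bij_betw_def)

lemma (in group) commuting_product_subgroup:
  assumes H: "subgroup H G" and K: "subgroup K G"
    and comm: "\<And>x y. x \<in> H \<Longrightarrow> y \<in> K \<Longrightarrow> x \<otimes> y = y \<otimes> x"
  shows "subgroup (H <#> K) G"
proof -
  interpret H: subgroup H G by (rule H)
  interpret K: subgroup K G by (rule K)
  show ?thesis
  proof (rule subgroupI)
    show "H <#> K \<subseteq> carrier G"
      by (rule setmult_subset_G) (rule H.subset, rule K.subset)
    show "H <#> K \<noteq> {}"
      using H.one_closed K.one_closed unfolding set_mult_def by blast
  next
    fix a assume "a \<in> H <#> K"
    then obtain h k where hk: "h \<in> H" "k \<in> K" "a = h \<otimes> k" by (auto simp: set_mult_def)
    then have "inv a = inv h \<otimes> inv k"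
      using comm[of "inv h" "inv k"] by (simp add: inv_mult_group)
    then show "inv a \<in> H <#> K" using hk by (auto simp: set_mult_def)
  next
    fix a a' assume "a \<in> H <#> K" "a' \<in> H <#> K"
    then obtain h k h' k' where hk: "h \<in> H" "k \<in> K" "a = h \<otimes> k" "h' \<in> H" "k' \<in> K" "a' = h' \<otimes> k'"
      by (auto simp: set_mult_def)
    then have "a \<otimes> a' = (h \<otimes> h') \<otimes> (k \<otimes> k')"
      using comm[of h' k] by (metis H.mem_carrier K.mem_carrier m_assoc m_closed)
    then show "a \<otimes> a' \<in> H <#> K" using hk by (auto simp: set_mult_def)
  qed
qed

text \<open>\<open>P\<close> is normal because \<open>C\<close> centralizes it. A commutator of two
  elements of \<open>P\<close> splits into one in \<open>Q\<close> and one in \<open>R\<close>, and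
  normality puts both back into \<open>P\<close>. So the perfect group \<open>P\<close> is the
  central product of \<open>P \<inter> Q\<close> and \<open>P \<inter> R\<close>, one of which must
  be all of \<open>P\<close>.\<close>

lemma (in group) indecomposable_factor_cases:
  assumes QR: "central_product G [Q, R]" and PC: "central_product G [P, C]"
    and P: "centrally_indecomposable (G\<lparr>carrier := P\<rparr>)"
  shows "P \<subseteq> Q \<or> P \<subseteq> R"
proof -
  have sg: "subgroup Q G" "subgroup R G" "subgroup P G" "subgroup C G"
    and G: "carrier G = Q <#> R" "carrier G = P <#> C"
    and cQR: "\<And>x y. x \<in> Q \<Longrightarrow> y \<in> R \<Longrightarrow> x \<otimes> y = y \<otimes> x"
    and cPC: "\<And>x y. x \<in> P \<Longrightarrow> y \<in> C \<Longrightarrow> x \<otimes> y = y \<otimes> x"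
    using QR PC unfolding central_product_pair_iff by blast+
  interpret Q: subgroup Q G by (rule sg)
  interpret R: subgroup R G by (rule sg)
  interpret P: subgroup P G by (rule sg)
  interpret C: subgroup C G by (rule sg)
  have conj: "g \<otimes> x \<otimes> inv g \<in> P" if g: "g \<in> carrier G" and x: "x \<in> P" for g x
  proof -
    obtain p c where pc: "p \<in> P" "c \<in> C" "g = p \<otimes> c" using g G(2) by (auto simp: set_mult_def)
    have "g \<otimes> x \<otimes> inv g = p \<otimes> (c \<otimes> x) \<otimes> inv c \<otimes> inv p"
      using pc x P.mem_carrier C.mem_carrier by (simp add: inv_mult_group m_assoc)
    also have "c \<otimes> x = x \<otimes> c" by (rule cPC[OF x pc(2), symmetric])
    also have "p \<otimes> (x \<otimes> c) \<otimes> inv c \<otimes> inv p = p \<otimes> x \<otimes> inv p"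
      using pc x P.mem_carrier C.mem_carrier by (simp add: m_assoc)
    finally show ?thesis using pc x by simp
  qed
  let ?H = "P \<inter> Q" and ?K = "P \<inter> R"
  have sH: "subgroup ?H G" and sK: "subgroup ?K G"
    using sg subgroups_Inter_pair by blast+
  have HK: "subgroup (?H <#> ?K) G"
    by (rule commuting_product_subgroup[OF sH sK]) (use cQR in auto)
  have "x \<otimes> y \<otimes> inv x \<otimes> inv y \<in> ?H <#> ?K" if x: "x \<in> P" and y: "y \<in> P" for x y
  proof -
    have "x \<in> carrier G" "y \<in> carrier G" using x y by auto
    then obtain q r q' r' where qr: "q \<in> Q" "r \<in> R" "x = q \<otimes> r" "q' \<in> Q" "r' \<in> R" "y = q' \<otimes> r'"
      unfolding G(1) by (auto simp: set_mult_def)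
    have c: "q \<in> carrier G" "r \<in> carrier G" "q' \<in> carrier G" "r' \<in> carrier G"
      using qr by auto
    have i1: "inv x = inv r \<otimes> inv q" and i3: "inv y = inv r' \<otimes> inv q'"
      unfolding qr(3,6) using c by (simp_all only: inv_mult_group)
    have i2: "inv x = inv q \<otimes> inv r"
      unfolding i1 by (rule cQR[symmetric]) (use qr in simp_all)
    \<comment> \<open>The commutator of \<open>x\<close> and \<open>q'\<close> is that of
      \<open>q\<close> and \<open>q'\<close>, since \<open>r\<close> commutes with
      \<open>q'\<close>. The left side shows that it lies in \<open>P\<close>, the right side that
      it lies in \<open>Q\<close>.\<close>
    have 1: "x \<otimes> (q' \<otimes> inv x \<otimes> inv q') = q \<otimes> q' \<otimes> inv q \<otimes> inv q'"
    proof -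
      have "x \<otimes> (q' \<otimes> inv x \<otimes> inv q') = q \<otimes> (r \<otimes> q') \<otimes> inv r \<otimes> inv q \<otimes> inv q'"
        unfolding i1 unfolding qr(3) using c by (simp add: m_assoc)
      also have "r \<otimes> q' = q' \<otimes> r" by (rule cQR[OF qr(4,2), symmetric])
      also have "q \<otimes> (q' \<otimes> r) \<otimes> inv r \<otimes> inv q \<otimes> inv q' = q \<otimes> q' \<otimes> (r \<otimes> inv r) \<otimes> inv q \<otimes> inv q'"
        using c by (simp only: m_assoc m_closed inv_closed)
      finally show ?thesis using c by simp
    qed
    have 2: "x \<otimes> (r' \<otimes> inv x \<otimes> inv r') = r \<otimes> r' \<otimes> inv r \<otimes> inv r'"
    proof -
      have "x \<otimes> (r' \<otimes> inv x \<otimes> inv r') = (q \<otimes> r) \<otimes> r' \<otimes> inv q \<otimes> inv r \<otimes> inv r'"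
        unfolding i2 unfolding qr(3) using c by (simp add: m_assoc)
      also have "q \<otimes> r = r \<otimes> q" by (rule cQR[OF qr(1,2)])
      also have "r \<otimes> q \<otimes> r' \<otimes> inv q \<otimes> inv r \<otimes> inv r' = r \<otimes> (q \<otimes> r') \<otimes> inv q \<otimes> inv r \<otimes> inv r'"
        using c by (simp add: m_assoc)
      also have "q \<otimes> r' = r' \<otimes> q" by (rule cQR[OF qr(1,5)])
      also have "r \<otimes> (r' \<otimes> q) \<otimes> inv q \<otimes> inv r \<otimes> inv r' = r \<otimes> r' \<otimes> (q \<otimes> inv q) \<otimes> inv r \<otimes> inv r'"
        using c by (simp only: m_assoc m_closed inv_closed)
      finally show ?thesis using c by simp
    qed
    have H1: "q \<otimes> q' \<otimes> inv q \<otimes> inv q' \<in> ?H"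
      using 1 conj[of q' "inv x"] x c qr by (metis IntI P.m_closed P.m_inv_closed Q.m_closed Q.m_inv_closed)
    have K1: "r \<otimes> r' \<otimes> inv r \<otimes> inv r' \<in> ?K"
      using 2 conj[of r' "inv x"] x c qr by (metis IntI P.m_closed P.m_inv_closed R.m_closed R.m_inv_closed)
    have "x \<otimes> y \<otimes> inv x \<otimes> inv y = (q \<otimes> q' \<otimes> inv q \<otimes> inv q') \<otimes> (r \<otimes> r' \<otimes> inv r \<otimes> inv r')"
    proof -
      have xy: "x \<otimes> y = (q \<otimes> q') \<otimes> (r \<otimes> r')"
        unfolding qr(3,6) by (rule mult_interchange) (use c cQR[OF qr(4,2)] in simp_all)
      have i3': "inv y = inv q' \<otimes> inv r'"
        unfolding i3 by (rule cQR[symmetric]) (use qr in simp_all)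
      have "inv q' \<otimes> inv r = inv r \<otimes> inv q'"
        by (rule cQR) (use qr in simp_all)
      then have ixy: "inv x \<otimes> inv y = (inv q \<otimes> inv q') \<otimes> (inv r \<otimes> inv r')"
        unfolding i2 i3' by (intro mult_interchange) (use c in simp_all)
      have "x \<otimes> y \<otimes> inv x \<otimes> inv y = (x \<otimes> y) \<otimes> (inv x \<otimes> inv y)"
        using x y by (simp add: m_assoc)
      also have "\<dots> = (q \<otimes> q') \<otimes> ((r \<otimes> r') \<otimes> (inv q \<otimes> inv q')) \<otimes> (inv r \<otimes> inv r')"
        unfolding xy ixy using c by (simp add: m_assoc)
      also have "(r \<otimes> r') \<otimes> (inv q \<otimes> inv q') = (inv q \<otimes> inv q') \<otimes> (r \<otimes> r')"
        by (rule cQR[symmetric]) (use qr in simp_all)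
      finally show ?thesis using c by (simp add: m_assoc)
    qed
    then show ?thesis using H1 K1 by (auto simp: set_mult_def)
  qed
  then have "derived G P \<subseteq> ?H <#> ?K"
    unfolding derived_def by (intro generate_subgroup_incl HK) auto
  moreover have "derived G P = P"
    using P derived_consistent[OF subset_refl sg(3)]
    by (simp add: centrally_indecomposable_def perfect_group_def)
  moreover have "?H <#> ?K \<subseteq> P" by (auto simp: set_mult_def)
  ultimately have "P = ?H <#> ?K" by blast
  then have PHK: "P = ?H <#>\<^bsub>G\<lparr>carrier := P\<rparr>\<^esub> ?K" by (simp add: set_mult_def)
  have "central_product (G\<lparr>carrier := P\<rparr>) [?H, ?K]"
    unfolding central_product_pair_iff
  proof (intro conjI ballI)
    show "group (G\<lparr>carrier := P\<rparr>)" by (rule P.subgroup_is_group[OF is_group])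
    show "subgroup ?H (G\<lparr>carrier := P\<rparr>)" by (rule subgroup_incl[OF sH sg(3)]) blast
    show "subgroup ?K (G\<lparr>carrier := P\<rparr>)" by (rule subgroup_incl[OF sK sg(3)]) blast
    show "carrier (G\<lparr>carrier := P\<rparr>) = ?H <#>\<^bsub>G\<lparr>carrier := P\<rparr>\<^esub> ?K"
      using PHK by simp
    fix x y assume "x \<in> ?H" "y \<in> ?K"
    then have "x \<otimes> y = y \<otimes> x" by (intro cQR) auto
    then show "x \<otimes>\<^bsub>G\<lparr>carrier := P\<rparr>\<^esub> y = y \<otimes>\<^bsub>G\<lparr>carrier := P\<rparr>\<^esub> x"
      by simp
  qed
  then have "\<not> (?H \<subset> P \<and> ?K \<subset> P)"
    using P unfolding centrally_indecomposable_def by auto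
  then show ?thesis by blast
qed

section \<open>Central products of three factors\<close>

lemma central_product_triple_iff:
  "central_product G [Q1, Q2, Q3] \<longleftrightarrow>
     group G \<and> subgroup Q1 G \<and> subgroup Q2 G \<and> subgroup Q3 G \<and>
     carrier G = Q1 <#>\<^bsub>G\<^esub> (Q2 <#>\<^bsub>G\<^esub> Q3) \<and>
     (\<forall>x \<in> Q1. \<forall>y \<in> Q2. x \<otimes>\<^bsub>G\<^esub> y = y \<otimes>\<^bsub>G\<^esub> x) \<and>
     (\<forall>x \<in> Q1. \<forall>y \<in> Q3. x \<otimes>\<^bsub>G\<^esub> y = y \<otimes>\<^bsub>G\<^esub> x) \<and>
     (\<forall>x \<in> Q2. \<forall>y \<in> Q3. x \<otimes>\<^bsub>G\<^esub> y = y \<otimes>\<^bsub>G\<^esub> x)"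
proof (cases "group G \<and> subgroup Q1 G \<and> subgroup Q2 G \<and> subgroup Q3 G")
  case True
  then interpret group G by simp
  have sub: "Q1 \<subseteq> carrier G" "Q2 \<subseteq> carrier G" "Q3 \<subseteq> carrier G"
    using True subgroup.subset by auto
  have one: "Q3 <#>\<^bsub>G\<^esub> {\<one>\<^bsub>G\<^esub>} = Q3"
    using sub(3) unfolding set_mult_def by (auto simp: subset_iff)
  have sym: "(\<forall>h \<in> A. \<forall>k \<in> B. h \<otimes>\<^bsub>G\<^esub> k = k \<otimes>\<^bsub>G\<^esub> h) \<longleftrightarrow>
      (\<forall>h \<in> B. \<forall>k \<in> A. h \<otimes>\<^bsub>G\<^esub> k = k \<otimes>\<^bsub>G\<^esub> h)" for A B
    by metis
  have "(\<forall>i < length [Q1, Q2, Q3]. \<forall>j < length [Q1, Q2, Q3]. i \<noteq> j \<longrightarrow>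
          commutator_subgroup G ([Q1, Q2, Q3] ! i) ([Q1, Q2, Q3] ! j) = {\<one>\<^bsub>G\<^esub>}) \<longleftrightarrow>
        (commutator_subgroup G Q1 Q2 = {\<one>\<^bsub>G\<^esub>} \<and> commutator_subgroup G Q2 Q1 = {\<one>\<^bsub>G\<^esub>}) \<and>
        (commutator_subgroup G Q1 Q3 = {\<one>\<^bsub>G\<^esub>} \<and> commutator_subgroup G Q3 Q1 = {\<one>\<^bsub>G\<^esub>}) \<and>
        (commutator_subgroup G Q2 Q3 = {\<one>\<^bsub>G\<^esub>} \<and> commutator_subgroup G Q3 Q2 = {\<one>\<^bsub>G\<^esub>})"
    by (auto simp: less_Suc_eq)
  also have "\<dots> \<longleftrightarrow> (\<forall>x \<in> Q1. \<forall>y \<in> Q2. x \<otimes>\<^bsub>G\<^esub> y = y \<otimes>\<^bsub>G\<^esub> x) \<and>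
     (\<forall>x \<in> Q1. \<forall>y \<in> Q3. x \<otimes>\<^bsub>G\<^esub> y = y \<otimes>\<^bsub>G\<^esub> x) \<and>
     (\<forall>x \<in> Q2. \<forall>y \<in> Q3. x \<otimes>\<^bsub>G\<^esub> y = y \<otimes>\<^bsub>G\<^esub> x)"
    unfolding commutator_subgroup_trivial_iff[OF is_group sub(1) sub(2)]
      commutator_subgroup_trivial_iff[OF is_group sub(2) sub(1)]
      commutator_subgroup_trivial_iff[OF is_group sub(1) sub(3)]
      commutator_subgroup_trivial_iff[OF is_group sub(3) sub(1)]
      commutator_subgroup_trivial_iff[OF is_group sub(2) sub(3)]
      commutator_subgroup_trivial_iff[OF is_group sub(3) sub(2)]
    using sym[of Q1 Q2] sym[of Q1 Q3] sym[of Q2 Q3] by argo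
  finally show ?thesis
    unfolding central_product_def using True one by auto
next
  case False
  then show ?thesis
    unfolding central_product_def by auto
qed

lemma central_product_swap:
  assumes "central_product G [Q1, Q2, Q3]"
  shows "central_product G [Q2, Q1, Q3]" "central_product G [Q1, Q3, Q2]"
proof -
  have g: "group G" and s: "subgroup Q1 G" "subgroup Q2 G" "subgroup Q3 G"
    and G: "carrier G = Q1 <#>\<^bsub>G\<^esub> (Q2 <#>\<^bsub>G\<^esub> Q3)"
    and c12: "\<And>x y. x \<in> Q1 \<Longrightarrow> y \<in> Q2 \<Longrightarrow> x \<otimes>\<^bsub>G\<^esub> y = y \<otimes>\<^bsub>G\<^esub> x"
    and c13: "\<And>x y. x \<in> Q1 \<Longrightarrow> y \<in> Q3 \<Longrightarrow> x \<otimes>\<^bsub>G\<^esub> y = y \<otimes>\<^bsub>G\<^esub> x"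
    and c23: "\<And>x y. x \<in> Q2 \<Longrightarrow> y \<in> Q3 \<Longrightarrow> x \<otimes>\<^bsub>G\<^esub> y = y \<otimes>\<^bsub>G\<^esub> x"
    using assms unfolding central_product_triple_iff by blast+
  interpret group G by (rule g)
  note sub = s[THEN subgroup.subset]
  have 12: "Q1 <#>\<^bsub>G\<^esub> Q2 = Q2 <#>\<^bsub>G\<^esub> Q1" by (rule set_mult_commute) (rule c12)
  have 23: "Q2 <#>\<^bsub>G\<^esub> Q3 = Q3 <#>\<^bsub>G\<^esub> Q2" by (rule set_mult_commute) (rule c23)
  have "carrier G = Q2 <#>\<^bsub>G\<^esub> (Q1 <#>\<^bsub>G\<^esub> Q3)"
    using G set_mult_assoc sub 12 by metis
  then show "central_product G [Q2, Q1, Q3]"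
    unfolding central_product_triple_iff using g s c12[symmetric] c13 c23 by blast
  show "central_product G [Q1, Q3, Q2]"
    unfolding central_product_triple_iff using g s c12 c13 c23[symmetric] G[unfolded 23] by blast
qed

text \<open>If \<open>P\<close> lay in none of the factors, the two-factor case would put it into
  each product of two of them. It would then commute with all three factors and be central, but an
  abelian perfect group is trivial.\<close>

lemma (in group) indecomposable_triple_cases:
  assumes QR: "central_product G [Q1, Q2, Q3]" and PC: "central_product G [P, C]"
    and P: "centrally_indecomposable (G\<lparr>carrier := P\<rparr>)"
  shows "P \<subseteq> Q1 \<or> P \<subseteq> Q2 \<or> P \<subseteq> Q3"
proof (rule ccontr)
  assume neg: "\<not> ?thesis"
  have p1: "central_product G [Q1, Q2 <#> Q3]"
    by (rule central_product_triple_imp_pair[OF QR])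
  have p2: "central_product G [Q2, Q1 <#> Q3]"
    by (rule central_product_triple_imp_pair[OF central_product_swap(1)[OF QR]])
  have p3: "central_product G [Q3, Q1 <#> Q2]"
    by (rule central_product_triple_imp_pair[OF central_product_swap(1)[OF central_product_swap(2)[OF QR]]])
  have sub: "P \<subseteq> Q2 <#> Q3" "P \<subseteq> Q1 <#> Q3" "P \<subseteq> Q1 <#> Q2"
    using neg indecomposable_factor_cases[OF p1 PC P] indecomposable_factor_cases[OF p2 PC P]
      indecomposable_factor_cases[OF p3 PC P] by blast+
  have c: "q \<otimes> x = x \<otimes> q" if "x \<in> P" "q \<in> Q1 \<or> q \<in> Q2 \<or> q \<in> Q3" for x q
    using that sub p1 p2 p3 unfolding central_product_pair_iff by blast
  have sP: "subgroup P G" using PC unfolding central_product_pair_iff by blast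
  have sQ: "Q1 \<subseteq> carrier G" "Q2 \<subseteq> carrier G" "Q3 \<subseteq> carrier G"
    using QR subgroup.subset unfolding central_product_triple_iff by blast+
  interpret P: subgroup P G by (rule sP)
  have cc: "x \<otimes> y = y \<otimes> x" if x: "x \<in> P" and y: "y \<in> carrier G" for x y
  proof -
    have "y \<in> Q1 <#> (Q2 <#> Q3)" using y QR unfolding central_product_triple_iff by blast
    then obtain a b d where abd: "a \<in> Q1" "b \<in> Q2" "d \<in> Q3" "y = a \<otimes> (b \<otimes> d)"
      unfolding set_mult_def by blast
    have car: "a \<in> carrier G" "b \<in> carrier G" "d \<in> carrier G" "x \<in> carrier G"
      using abd sQ x by auto
    have "x \<otimes> y = (x \<otimes> a) \<otimes> b \<otimes> d" unfolding abd using car by (simp only: m_assoc m_closed)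
    also have "x \<otimes> a = a \<otimes> x" by (rule c[symmetric]) (use x abd in simp_all)
    also have "a \<otimes> x \<otimes> b \<otimes> d = a \<otimes> (x \<otimes> b) \<otimes> d" using car by (simp only: m_assoc m_closed)
    also have "x \<otimes> b = b \<otimes> x" by (rule c[symmetric]) (use x abd in simp_all)
    also have "a \<otimes> (b \<otimes> x) \<otimes> d = a \<otimes> b \<otimes> (x \<otimes> d)" using car by (simp only: m_assoc m_closed)
    also have "x \<otimes> d = d \<otimes> x" by (rule c[symmetric]) (use x abd in simp_all)
    finally show ?thesis unfolding abd using car by (simp only: m_assoc m_closed)
  qed
  let ?P = "G\<lparr>carrier := P\<rparr>"
  interpret PP: group ?P by (rule P.subgroup_is_group[OF is_group])
  have "{\<one>\<^bsub>?P\<^esub>} = carrier ?P"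
  \<comment> \<open>Applied with the trivial subgroup as \<open>H\<close> and all of
    \<open>P\<close> as the central set \<open>K\<close>.\<close>
  proof (rule PP.perfect_central_factor)
    show "derived ?P (carrier ?P) = carrier ?P"
      using P unfolding centrally_indecomposable_def perfect_group_def by blast
    show "subgroup {\<one>\<^bsub>?P\<^esub>} ?P" by (rule PP.triv_subgroup)
    show "carrier ?P = {\<one>\<^bsub>?P\<^esub>} <#>\<^bsub>?P\<^esub> P"
      using P.mem_carrier unfolding set_mult_def by auto
    show "P \<subseteq> carrier ?P" by simp
    show "k \<otimes>\<^bsub>?P\<^esub> x = x \<otimes>\<^bsub>?P\<^esub> k" if "k \<in> P" "x \<in> carrier ?P" for k x
      using cc[of k x] that P.mem_carrier by simp
  qed
  then show False using P unfolding centrally_indecomposable_def by metis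
qed

section \<open>Images of subgroups and central products under automorphisms\<close>

lemma (in group) auto_iso_restrict:
  assumes phi: "\<phi> \<in> auto G" and P: "P \<subseteq> carrier G"
  shows "\<phi> \<in> iso (G\<lparr>carrier := P\<rparr>) (G\<lparr>carrier := \<phi> ` P\<rparr>)"
proof -
  have "\<phi> \<in> hom G G" "inj_on \<phi> (carrier G)" using phi by (auto simp: auto_def Bij_def bij_betw_def)
  then have "\<phi> \<in> hom (G\<lparr>carrier := P\<rparr>) G" "inj_on \<phi> P"
    using P by (auto simp: hom_def intro: inj_on_subset)
  then show ?thesis using hom_iso_image[of \<phi> "G\<lparr>carrier := P\<rparr>" G] by simp
qed

lemma (in group) auto_central_product:
  assumes phi: "\<phi> \<in> auto G" and PC: "central_product G [P, C]"
  shows "central_product G [\<phi> ` P, \<phi> ` C]"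
proof -
  have hom: "\<phi> \<in> hom G G" and img: "\<phi> ` carrier G = carrier G"
    using phi by (auto simp: auto_def Bij_def bij_betw_def)
  interpret h: group_hom G G \<phi> by unfold_locales (rule hom)
  have s: "subgroup P G" "subgroup C G" and G: "carrier G = P <#> C"
    and c: "\<And>x y. x \<in> P \<Longrightarrow> y \<in> C \<Longrightarrow> x \<otimes> y = y \<otimes> x"
    using PC unfolding central_product_pair_iff by blast+
  note sub = s[THEN subgroup.subset]
  show ?thesis unfolding central_product_pair_iff
  proof (intro conjI ballI)
    show "group G" by (rule is_group)
    show "subgroup (\<phi> ` P) G" "subgroup (\<phi> ` C) G"
      by (rule h.subgroup_img_is_subgroup, rule s)+
    show "carrier G = \<phi> ` P <#> \<phi> ` C"
      using set_mult_hom[OF hom sub] img G by simp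
    fix x y assume "x \<in> \<phi> ` P" "y \<in> \<phi> ` C"
    then obtain p q where pq: "p \<in> P" "q \<in> C" "x = \<phi> p" "y = \<phi> q" by blast
    then have car: "p \<in> carrier G" "q \<in> carrier G" using sub by auto
    show "x \<otimes> y = y \<otimes> x"
      unfolding pq(3,4) h.hom_mult[OF car, symmetric] h.hom_mult[OF car(2,1), symmetric]
      by (simp only: c[OF pq(1,2)])
  qed
qed

text \<open>Serves to move a finite group onto natural numbers: the structure is transported along
  an injection into another type.\<close>

lemma (in group) inj_image_group:
  assumes "inj_on f (carrier G)"
  obtains H :: "'c monoid" where "group H" "f \<in> iso G H"
proof -
  let ?g = "inv_into (carrier G) f"
  let ?H = "\<lparr>carrier = f ` carrier G, monoid.mult = (\<lambda>x y. f (?g x \<otimes> ?g y)), one = f \<one>\<rparr>"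
  have "f \<in> hom G ?H" by (simp add: hom_def inv_into_f_f[OF assms])
  then have iso: "f \<in> iso G ?H" using assms by (simp add: iso_def bij_betw_def)
  have "group (?H\<lparr>one := f \<one>\<rparr>)"
    using iso by (rule iso_imp_img_group)
  then show thesis using that[of ?H] iso by simp
qed

section \<open>The field with 11 elements\<close>

text \<open>Three properties of the prime 11 matter: -1 is not a square modulo 11, SL(2,11) contains
  a copy of SL(2,5), and 11 does not divide the order 120 of that copy.\<close>

typedef f11 = "{0..<11::int}" by (rule exI[of _ 0]) simp

setup_lifting type_definition_f11

instantiation f11 :: comm_ring_1
begin
lift_definition zero_f11 :: f11 is 0 by simp
lift_definition one_f11 :: f11 is 1 by simp
lift_definition plus_f11 :: "f11 \<Rightarrow> f11 \<Rightarrow> f11" is "\<lambda>a b. (a + b) mod 11" by simp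
lift_definition minus_f11 :: "f11 \<Rightarrow> f11 \<Rightarrow> f11" is "\<lambda>a b. (a - b) mod 11" by simp
lift_definition uminus_f11 :: "f11 \<Rightarrow> f11" is "\<lambda>a. (- a) mod 11" by simp
lift_definition times_f11 :: "f11 \<Rightarrow> f11 \<Rightarrow> f11" is "\<lambda>a b. (a * b) mod 11" by simp
instance
  by standard (transfer; simp add: mod_simps algebra_simps)+
end

lemma Rep_f11_of_nat: "Rep_f11 (of_nat n) = int n mod 11"
  by (induction n) (simp_all add: zero_f11.rep_eq one_f11.rep_eq plus_f11.rep_eq mod_simps)

lemma Rep_f11_of_int: "Rep_f11 (of_int k) = k mod 11"
  by (cases k rule: int_diff_cases)
    (simp add: minus_f11.rep_eq Rep_f11_of_nat mod_simps)

lemma of_int_f11_eq_iff: "(of_int a :: f11) = of_int b \<longleftrightarrow> a mod 11 = b mod 11"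
  by (simp add: Rep_f11_inject[symmetric] Rep_f11_of_int)

lemma f11_cases: obtains k where "x = (of_int k :: f11)" "k \<in> {0..<11}"
proof
  show "Rep_f11 x \<in> {0..<11}" by (rule Rep_f11)
  then show "x = of_int (Rep_f11 x)" by (simp add: Rep_f11_inject[symmetric] Rep_f11_of_int)
qed

instance f11 :: finite
proof
  have "UNIV \<subseteq> (of_int :: int \<Rightarrow> f11) ` {0..<11}"
    using f11_cases by blast
  then show "finite (UNIV :: f11 set)"
    by (rule finite_subset) simp
qed

lemma of_int_f11_eq_0_iff: "(of_int a :: f11) = 0 \<longleftrightarrow> 11 dvd a"
  using of_int_f11_eq_iff[of a 0] by (simp add: dvd_eq_mod_eq_0)

instance f11 :: idom
proof
  fix a b :: f11
  assume nz: "a \<noteq> 0" "b \<noteq> 0"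
  obtain k l where kl: "a = of_int k" "b = of_int l" using f11_cases by metis
  have "\<not> 11 dvd k" "\<not> 11 dvd l"
    using nz unfolding kl of_int_f11_eq_0_iff .
  moreover have "Factorial_Ring.prime (11::int)" by simp
  ultimately have "\<not> 11 dvd k * l" using prime_dvd_mult_iff by blast
  then show "a * b \<noteq> 0"
    unfolding kl of_int_mult[symmetric] of_int_f11_eq_0_iff .
qed

text \<open>As rewrite rules these decide equations between numerals by integer arithmetic, which is
  how concrete matrix products are evaluated.\<close>

lemma f11_numeral_eq_iff [simp]:
  "(numeral m :: f11) = numeral n \<longleftrightarrow> (numeral m :: int) mod 11 = numeral n mod 11"
  "(numeral m :: f11) = 1 \<longleftrightarrow> (numeral m :: int) mod 11 = 1"
  "(numeral m :: f11) = 0 \<longleftrightarrow> (numeral m :: int) mod 11 = 0"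
  "(- numeral m :: f11) = numeral n \<longleftrightarrow> (- numeral m :: int) mod 11 = numeral n mod 11"
  "(- numeral m :: f11) = 1 \<longleftrightarrow> (- numeral m :: int) mod 11 = 1"
  "(numeral m :: f11) = -1 \<longleftrightarrow> (numeral m :: int) mod 11 = 10"
  "(-1 :: f11) \<noteq> 1"
  using of_int_f11_eq_iff[of "numeral m" "numeral n"] of_int_f11_eq_iff[of "numeral m" 1]
    of_int_f11_eq_iff[of "numeral m" 0] of_int_f11_eq_iff[of "- numeral m" "numeral n"]
    of_int_f11_eq_iff[of "- numeral m" 1] of_int_f11_eq_iff[of "numeral m" "-1"]
    of_int_f11_eq_iff[of "-1" 1]
  by simp_all

lemma f11_numeral_eq_iff' [simp]:
  "(1 :: f11) = numeral m \<longleftrightarrow> (numeral m :: int) mod 11 = 1"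
  "(0 :: f11) = numeral m \<longleftrightarrow> (numeral m :: int) mod 11 = 0"
  "(numeral n :: f11) = - numeral m \<longleftrightarrow> (- numeral m :: int) mod 11 = numeral n mod 11"
  "(1 :: f11) = - numeral m \<longleftrightarrow> (- numeral m :: int) mod 11 = 1"
  "(-1 :: f11) = numeral m \<longleftrightarrow> (numeral m :: int) mod 11 = 10"
  "(1 :: f11) \<noteq> -1"
  by (metis f11_numeral_eq_iff)+

text \<open>In a prime field every element is a multiple of 1, so additivity alone gives
  linearity.\<close>

lemma f11_additive:
  assumes "\<And>x y. f (x + y) = f x + (f y :: f11)"
  shows "f x = x * f 1"
proof -
  have 0: "f 0 = 0" using assms[of 0 0] by simp
  have n: "f (of_nat n) = of_nat n * f 1" for n
    by (induction n) (simp_all add: 0 assms algebra_simps)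
  obtain k where "x = of_int k" "k \<in> {0..<11}" by (rule f11_cases)
  then have "x = of_nat (nat k)" by simp
  then show ?thesis using n by metis
qed

lemma f11_eleven: "of_nat 11 * (x :: f11) = 0"
proof -
  have "(11 :: f11) = 0" by simp
  then show ?thesis by (metis mult_zero_left of_nat_numeral)
qed

text \<open>This is the fact that -1 is not a square, as 11 is 3 modulo 4; it is checked on all
  pairs of residues.\<close>

lemma f11_not_neg_square:
  assumes "(x::f11) * x = - (y * y)" shows "x = 0"
proof -
  obtain k l where kl: "x = of_int k" "y = of_int l" "k \<in> {0..<11}" "l \<in> {0..<11}"
    using f11_cases by metis
  have "(of_int (k*k+l*l) :: f11) = of_int 0" using assms by (simp add: kl)
  then have "(k * k + l * l) mod 11 = 0" unfolding of_int_f11_eq_iff by simp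
  moreover have "i \<in> {0,1,2,3,4,5,6,7,8,9,10}" if "i \<in> {0..<11}" for i :: int
    using that unfolding insert_iff empty_iff atLeastLessThan_iff by arith
  then have "k \<in> {0,1,2,3,4,5,6,7,8,9,10}" "l \<in> {0,1,2,3,4,5,6,7,8,9,10}"
    using kl by blast+
  ultimately have "k = 0" by (elim insertE emptyE) simp_all
  then show ?thesis by (simp add: kl)
qed

section \<open>The binary icosahedral group in characteristic 11\<close>

type_synonym vec = "f11 \<times> f11"
type_synonym mat = "f11 \<times> f11 \<times> f11 \<times> f11"

fun mat_mult :: "mat \<Rightarrow> mat \<Rightarrow> mat" where
  "mat_mult (a, b, c, d) (a', b', c', d') =
     (a * a' + b * c', a * b' + b * d', c * a' + d * c', c * b' + d * d')"

fun mat_det :: "mat \<Rightarrow> f11" where "mat_det (a, b, c, d) = a * d - b * c"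

text \<open>The adjugate, which is the inverse on matrices of determinant 1 and requires no
  division.\<close>

fun adj :: "mat \<Rightarrow> mat" where "adj (a, b, c, d) = (d, - b, - c, a)"

fun mat_vec :: "mat \<Rightarrow> vec \<Rightarrow> vec" where
  "mat_vec (a, b, c, d) (x, y) = (a * x + b * y, c * x + d * y)"

text \<open>The determinant of the matrix with the two vectors as columns; therefore a matrix
  multiplies it by its own determinant.\<close>

fun symp :: "vec \<Rightarrow> vec \<Rightarrow> f11" where "symp (x, y) (x', y') = x * y' - y * x'"

definition mat_one :: mat where "mat_one = (1, 0, 0, 1)"
definition mat_neg_one :: mat where "mat_neg_one = (-1, 0, 0, -1)"
text \<open>2 is a primitive root modulo 11 with inverse 6. \<open>gen4\<close> has trace 0 and
  determinant 1, hence square -1.\<close>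

definition gen10 :: mat where "gen10 = (2, 0, 0, 6)"
definition gen4 :: mat where "gen4 = (1, 1, 9, 10)"

lemma mat_mult_assoc: "mat_mult (mat_mult a b) c = mat_mult a (mat_mult b c)"
  by (cases a; cases b; cases c) (simp add: algebra_simps)

lemma mat_mult_mat_one [simp]: "mat_mult mat_one a = a" "mat_mult a mat_one = a"
  by (cases a; simp add: mat_one_def)+

lemma mat_det_mat_mult: "mat_det (mat_mult a b) = mat_det a * mat_det b"
  by (cases a; cases b) (simp add: algebra_simps)

lemma adj_mat_mult: "adj (mat_mult a b) = mat_mult (adj b) (adj a)"
  by (cases a; cases b) (simp add: algebra_simps)

lemma mat_mult_adj: "mat_det a = 1 \<Longrightarrow> mat_mult a (adj a) = mat_one" "mat_det a = 1 \<Longrightarrow> mat_mult (adj a) a = mat_one"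
  by (cases a; simp add: mat_one_def algebra_simps)+

text \<open>\<open>True\<close> stands for \<open>gen4\<close> and \<open>False\<close> for
  \<open>gen10\<close>. Positive words suffice for a group because the generators have finite
  order.\<close>

definition word :: "bool list \<Rightarrow> mat" where
  "word ws = foldr (\<lambda>b m. mat_mult (if b then gen4 else gen10) m) ws mat_one"

text \<open>
  \<open>gen10\<close> and \<open>gen4\<close>, of orders 10 and 4, generate a copy of \<open>SL(2,5)\<close>, the binary icosahedral
  group, in \<open>SL(2,11)\<close>; its 120 elements are listed in \<open>icos_list\<close>.
\<close>

definition icos :: "mat set" where "icos = range word"

lemma word_simps: "word [] = mat_one" "word (b # ws) = mat_mult (if b then gen4 else gen10) (word ws)"
  by (simp_all add: word_def)

lemma word_append: "word (xs @ ys) = mat_mult (word xs) (word ys)"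
  by (induction xs) (simp_all add: word_simps mat_mult_assoc)

lemma word_in_icos: "word ws \<in> icos"
  by (simp add: icos_def)

lemma icosI: "m = word ws \<Longrightarrow> m \<in> icos"
  by (simp add: icos_def)

lemma icos_mult: "a \<in> icos \<Longrightarrow> b \<in> icos \<Longrightarrow> mat_mult a b \<in> icos"
  unfolding icos_def by (auto simp flip: word_append)

lemma mat_one_icos: "mat_one \<in> icos"
  using word_in_icos[of "[]"] by (simp add: word_simps)

lemmas word_eval = word_simps gen4_def gen10_def mat_one_def mat_neg_one_def

lemma gen10_icos: "gen10 \<in> icos" and gen4_icos: "gen4 \<in> icos"
  using word_in_icos[of "[False]"] word_in_icos[of "[True]"] by (simp_all add: word_simps)

lemma mat_neg_one_icos: "mat_neg_one \<in> icos"
  by (rule icosI[of _ "[True, True]"]) (simp add: word_eval)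

lemma icos_induct [consumes 1, case_names mat_one gen4 gen10]:
  assumes "m \<in> icos" "P mat_one" "\<And>m. m \<in> icos \<Longrightarrow> P m \<Longrightarrow> P (mat_mult gen4 m)"
    "\<And>m. m \<in> icos \<Longrightarrow> P m \<Longrightarrow> P (mat_mult gen10 m)"
  shows "P m"
proof -
  have "P (word ws)" for ws
    by (induction ws) (use assms word_in_icos in \<open>auto simp: word_simps\<close>)
  then show ?thesis using assms(1) by (auto simp: icos_def)
qed

lemma icos_det: "m \<in> icos \<Longrightarrow> mat_det m = 1"
  by (induction rule: icos_induct) (auto simp: mat_det_mat_mult mat_one_def gen4_def gen10_def)

lemma icos_adj: "m \<in> icos \<Longrightarrow> adj m \<in> icos"
proof (induction rule: icos_induct)
  case mat_one
  have "adj mat_one = mat_one" by (simp add: mat_one_def)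
  then show ?case by (simp add: mat_one_icos)
next
  case (gen4 m)
  \<comment> \<open>\<open>gen4\<close> has order 4, so its inverse is its cube.\<close>
  have "adj gen4 = word [True, True, True]" by (simp add: word_eval)
  then show ?case using gen4 icos_mult word_in_icos by (metis adj_mat_mult)
next
  case (gen10 m)
  \<comment> \<open>The fifth power of \<open>gen10\<close> is -1, which is the square of
    \<open>gen4\<close>; so the inverse of \<open>gen10\<close> is that square times the fourth
    power of \<open>gen10\<close>.\<close>
  have "adj gen10 = word [True, True, False, False, False, False]" by (simp add: word_eval)
  then show ?case using gen10 icos_mult word_in_icos by (metis adj_mat_mult)
qed

section \<open>Computations with the list of the 120 elements\<close>

type_synonym imat = "int \<times> int \<times> int \<times> int"

text \<open>The entries are integer representatives, so that statements about all elements can be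
  evaluated by \<open>code_simp\<close>.\<close>

definition icos_list :: "imat list" where
  "icos_list = [
    (0,1,10,0), (0,2,5,0), (0,3,7,0), (0,4,8,0), (0,5,2,0), (0,6,9,0), (0,7,3,0), (0,8,4,0),
    (0,9,6,0), (0,10,1,0), (1,0,0,1), (1,1,9,10), (1,2,6,2), (1,3,3,10), (1,4,5,10), (1,5,4,10),
    (1,6,2,2), (1,7,8,2), (1,8,7,2), (1,9,1,10), (1,10,10,2), (2,0,0,6), (2,1,1,1), (2,2,10,5),
    (2,3,4,1), (2,4,3,1), (2,5,9,1), (2,6,7,5), (2,7,6,5), (2,8,8,5), (2,9,5,1), (2,10,2,5),
    (3,0,0,4), (3,1,9,7), (3,2,6,8), (3,3,3,7), (3,4,5,7), (3,5,4,7), (3,6,2,8), (3,7,8,8),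
    (3,8,7,8), (3,9,1,7), (3,10,10,8), (4,0,0,3), (4,1,9,8), (4,2,6,6), (4,3,3,8), (4,4,5,8),
    (4,5,4,8), (4,6,2,6), (4,7,8,6), (4,8,7,6), (4,9,1,8), (4,10,10,6), (5,0,0,9), (5,1,9,2),
    (5,2,6,7), (5,3,3,2), (5,4,5,2), (5,5,4,2), (5,6,2,7), (5,7,8,7), (5,8,7,7), (5,9,1,2),
    (5,10,10,7), (6,0,0,2), (6,1,1,4), (6,2,10,9), (6,3,4,4), (6,4,3,4), (6,5,9,4), (6,6,7,9),
    (6,7,6,9), (6,8,8,9), (6,9,5,4), (6,10,2,9), (7,0,0,8), (7,1,1,5), (7,2,10,3), (7,3,4,5),
    (7,4,3,5), (7,5,9,5), (7,6,7,3), (7,7,6,3), (7,8,8,3), (7,9,5,5), (7,10,2,3), (8,0,0,7),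
    (8,1,1,3), (8,2,10,4), (8,3,4,3), (8,4,3,3), (8,5,9,3), (8,6,7,4), (8,7,6,4), (8,8,8,4),
    (8,9,5,3), (8,10,2,4), (9,0,0,5), (9,1,9,6), (9,2,6,10), (9,3,3,6), (9,4,5,6), (9,5,4,6),
    (9,6,2,10), (9,7,8,10), (9,8,7,10), (9,9,1,6), (9,10,10,10), (10,0,0,10), (10,1,1,9),
    (10,2,10,1), (10,3,4,9), (10,4,3,9), (10,5,9,9), (10,6,7,1), (10,7,6,1), (10,8,8,1),
    (10,9,5,9), (10,10,2,1)
   ]"

fun imat_mult :: "imat \<Rightarrow> imat \<Rightarrow> imat" where
  "imat_mult (a, b, c, d) (a', b', c', d') =
     ((a * a' + b * c') mod 11, (a * b' + b * d') mod 11,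
      (c * a' + d * c') mod 11, (c * b' + d * d') mod 11)"

text \<open>The two factors represent \<open>gen4\<close> and \<open>gen10\<close>. Since the list
  also contains the identity, induction on words shows that it covers \<open>icos\<close>.\<close>

lemma icos_list_closed:
  "\<forall>m \<in> set icos_list. imat_mult (1, 1, 9, 10) m \<in> set icos_list \<and> imat_mult (2, 0, 0, 6) m \<in> set icos_list"
  by code_simp

text \<open>8 is the trace of \<open>gen10\<close>. SL(2,5) has two classes of elements of order 10,
  with twelve elements each, and the trace tells them apart.\<close>

lemma icos_list_trace:
  "\<forall>(a, b, c, d) \<in> set icos_list. (a + d) mod 11 = 8 \<longrightarrow>
     (a, b, c, d) \<in> set [(2,0,0,6), (6,0,0,2), (9,2,6,10), (9,6,2,10), (9,7,8,10), (9,8,7,10),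
       (9,10,10,10), (10,1,1,9), (10,3,4,9), (10,4,3,9), (10,5,9,9), (10,9,5,9)]"
  by code_simp

text \<open>The five values are the nonzero squares modulo 11. This is where the determinant of a
  normalizing matrix becomes a square.\<close>

lemma icos_list_diag:
  "\<forall>(a, b, c, d) \<in> set icos_list.
     a mod 11 = 1 \<and> d mod 11 = 10 \<longrightarrow> b \<in> set [1, 3, 4, 5, 9]"
  by code_simp

text \<open>The product is the 11th power, as 11 = 1 + 2 + 8, and 11 is prime to the group order
  120.\<close>

lemma icos_list_order:
  "\<forall>m \<in> set icos_list. (let m2 = imat_mult m m; m4 = imat_mult m2 m2; m8 = imat_mult m4 m4 in
     imat_mult m (imat_mult m2 m8)) = (1, 0, 0, 1) \<longrightarrow> m = (1, 0, 0, 1)"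
  by code_simp

fun mat_of_ints :: "imat \<Rightarrow> mat" where
  "mat_of_ints (a, b, c, d) = (of_int a, of_int b, of_int c, of_int d)"

lemma of_int_mod_11 [simp]: "(of_int (a mod 11) :: f11) = of_int a"
  by (simp add: of_int_f11_eq_iff)

lemma mat_of_ints_imat_mult: "mat_of_ints (imat_mult p q) = mat_mult (mat_of_ints p) (mat_of_ints q)"
  by (cases p; cases q) simp

lemma icos_in_list: "m \<in> icos \<Longrightarrow> m \<in> mat_of_ints ` set icos_list"
proof (induction rule: icos_induct)
  case mat_one
  have "(1, 0, 0, 1) \<in> set icos_list" by (simp add: icos_list_def)
  moreover have "mat_one = mat_of_ints (1, 0, 0, 1)" by (simp add: mat_one_def)
  ultimately show ?case by blast
next
  case (gen4 m)
  then obtain q where q: "q \<in> set icos_list" "m = mat_of_ints q" by blast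
  have "mat_mult gen4 m = mat_of_ints (imat_mult (1, 1, 9, 10) q)"
    by (simp add: q mat_of_ints_imat_mult gen4_def)
  then show ?case
    using icos_list_closed q(1) by auto
next
  case (gen10 m)
  then obtain q where q: "q \<in> set icos_list" "m = mat_of_ints q" by blast
  have "mat_mult gen10 m = mat_of_ints (imat_mult (2, 0, 0, 6) q)"
    by (simp add: q mat_of_ints_imat_mult gen10_def)
  then show ?case
    using icos_list_closed q(1) by auto
qed

lemma icos_diag:
  assumes "(1, b, c, 10) \<in> icos"
  shows "\<exists>t. b = t * t"
proof -
  obtain q where q: "q \<in> set icos_list" "(1, b, c, 10) = mat_of_ints q"
    using icos_in_list[OF assms] by blast
  obtain a' b' c' d' where q': "q = (a', b', c', d')" by (cases q)
  have "(of_int a' :: f11) = of_int 1" "(of_int d' :: f11) = of_int 10"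
    using q(2) by (simp_all add: q')
  then have "a' mod 11 = 1" "d' mod 11 = 10"
    unfolding of_int_f11_eq_iff by simp_all
  then have "b' \<in> {1, 3, 4, 5, 9}"
    using icos_list_diag q(1) unfolding q' by fastforce
  then have "b \<in> {1, 3, 4, 5, 9}"
    using q(2) by (auto simp: q')
  moreover have "(1 :: f11) = 1 * 1" "(3 :: f11) = 5 * 5" "(4 :: f11) = 2 * 2" "(5 :: f11) = 4 * 4"
    "(9 :: f11) = 3 * 3"
    by simp_all
  ultimately show ?thesis
    by blast
qed

lemma gen10_conj:
  assumes "m \<in> icos" "m = (a, b, c, d)" "a + d = 8"
  shows "\<exists>s\<in>icos. mat_mult s m = mat_mult gen10 s"
proof -
  obtain q where q: "q \<in> set icos_list" "m = mat_of_ints q"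
    using icos_in_list[OF assms(1)] by blast
  note q = q(1) q(2)[unfolded assms(2)]
  obtain a' b' c' d' where q': "q = (a', b', c', d')" by (cases q)
  have "(of_int (a' + d') :: f11) = of_int 8"
    using q(2) assms(3) by (simp add: q')
  then have "(a' + d') mod 11 = 8"
    unfolding of_int_f11_eq_iff by simp
  then have "q \<in> {(2,0,0,6), (6,0,0,2), (9,2,6,10), (9,6,2,10), (9,7,8,10), (9,8,7,10),
       (9,10,10,10), (10,1,1,9), (10,3,4,9), (10,4,3,9), (10,5,9,9), (10,9,5,9)}"
    using bspec[OF icos_list_trace q(1)] unfolding q' prod.case list.set by (rule mp[rotated])
  then have m: "m \<in> mat_of_ints ` {(2,0,0,6), (6,0,0,2), (9,2,6,10), (9,6,2,10), (9,7,8,10), (9,8,7,10),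
       (9,10,10,10), (10,1,1,9), (10,3,4,9), (10,4,3,9), (10,5,9,9), (10,9,5,9)}"
    unfolding assms(2) q(2) by (rule imageI)
  \<comment> \<open>A conjugating word is written out for each of the twelve candidates and checked
    by evaluation.\<close>
  have "\<exists>ws. mat_mult (word ws) m = mat_mult gen10 (word ws)"
    using m unfolding image_insert image_empty
  proof (elim insertE emptyE)
    assume "m = mat_of_ints (2, 0, 0, 6)"
    then show ?thesis by (intro exI[of _ "[]"]) (simp add: word_eval)
  next
    assume "m = mat_of_ints (6, 0, 0, 2)"
    then show ?thesis
      by (intro exI[of _ "[True, False, True, False, True, False, False, True]"]) (simp add: word_eval)
  next
    assume "m = mat_of_ints (9, 2, 6, 10)"
    then show ?thesis
      by (intro exI[of _ "[True, False, True, False, False]"]) (simp add: word_eval)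
  next
    assume "m = mat_of_ints (9, 6, 2, 10)"
    then show ?thesis
      by (intro exI[of _ "[True, False, False, False, False, True]"]) (simp add: word_eval)
  next
    assume "m = mat_of_ints (9, 7, 8, 10)"
    then show ?thesis
      by (intro exI[of _ "[True, False, True, False, True, False, False]"]) (simp add: word_eval)
  next
    assume "m = mat_of_ints (9, 8, 7, 10)"
    then show ?thesis by (intro exI[of _ "[True, False, True, False]"]) (simp add: word_eval)
  next
    assume "m = mat_of_ints (9, 10, 10, 10)"
    then show ?thesis by (intro exI[of _ "[True, False, True]"]) (simp add: word_eval)
  next
    assume "m = mat_of_ints (10, 1, 1, 9)"
    then show ?thesis by (intro exI[of _ "[True, False]"]) (simp add: word_eval)
  next
    assume "m = mat_of_ints (10, 3, 4, 9)"
    then show ?thesis by (intro exI[of _ "[True, False, False]"]) (simp add: word_eval)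
  next
    assume "m = mat_of_ints (10, 4, 3, 9)"
    then show ?thesis by (intro exI[of _ "[True]"]) (simp add: word_eval)
  next
    assume "m = mat_of_ints (10, 5, 9, 9)"
    then show ?thesis by (intro exI[of _ "[True, False, False, True, False]"]) (simp add: word_eval)
  next
    assume "m = mat_of_ints (10, 9, 5, 9)"
    then show ?thesis by (intro exI[of _ "[True, False, False, True]"]) (simp add: word_eval)
  qed
  then show ?thesis using word_in_icos by blast
qed

fun mat_pow :: "mat \<Rightarrow> nat \<Rightarrow> mat" where
  "mat_pow m 0 = mat_one" | "mat_pow m (Suc n) = mat_mult (mat_pow m n) m"

lemma imat_mult_mod: "\<exists>a b c d. imat_mult p q = (a mod 11, b mod 11, c mod 11, d mod 11)"
  by (cases p; cases q) auto

lemma icos_order_11: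
  assumes "m \<in> icos" "mat_pow m 11 = mat_one"
  shows "m = mat_one"
proof -
  obtain q where q: "q \<in> set icos_list" "m = mat_of_ints q"
    using icos_in_list[OF assms(1)] by blast
  \<comment> \<open>The 11th power of \<open>q\<close>, bracketed exactly as in
    \<open>icos_list_order\<close>.\<close>
  define r where "r = imat_mult q (imat_mult (imat_mult q q)
    (imat_mult (imat_mult (imat_mult q q) (imat_mult q q)) (imat_mult (imat_mult q q) (imat_mult q q))))"
  have "mat_pow m 11 = mat_of_ints r"
    by (simp only: r_def mat_of_ints_imat_mult q(2) eval_nat_numeral Num.BitM.simps mat_pow.simps mat_mult_assoc mat_mult_mat_one)
  \<comment> \<open>A product has entries already reduced modulo 11, so the equation in
    \<open>f11\<close> turns into an equation of integers.\<close>
  moreover obtain a b c d where r: "r = (a mod 11, b mod 11, c mod 11, d mod 11)"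
    unfolding r_def using imat_mult_mod by blast
  ultimately have "(of_int a :: f11) = of_int 1" "(of_int b :: f11) = of_int 0"
    "(of_int c :: f11) = of_int 0" "(of_int d :: f11) = of_int 1"
    using assms(2) by (simp_all add: mat_one_def)
  then have "r = (1, 0, 0, 1)"
    unfolding of_int_f11_eq_iff r by simp
  then have "q = (1, 0, 0, 1)"
    using icos_list_order q(1) unfolding r_def Let_def by blast
  then show ?thesis by (simp add: q(2) mat_one_def)
qed

text \<open>
  After multiplication by an element of \<open>icos\<close>, a matrix \<open>T\<close> normalizing \<open>icos\<close> commutes with \<open>gen10\<close>,
  because the elements of trace 8 form one conjugacy class. So \<open>T\<close> may be taken diagonal, and
  the ratio of its diagonal entries is read off from its action on \<open>gen4\<close>.
\<close>

lemma icos_normalizer_det: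
  assumes det: "mat_det T \<noteq> 0"
    and norm: "\<And>s. s \<in> icos \<Longrightarrow> \<exists>s'\<in>icos. mat_mult T s = mat_mult s' T"
  shows "\<exists>t. mat_det T = t * t"
proof -
  obtain g where g: "g \<in> icos" "mat_mult T gen10 = mat_mult g T"
    using norm[OF gen10_icos] by blast
  obtain p q r w where T: "T = (p, q, r, w)" by (cases T)
  obtain a b c d where gm: "g = (a, b, c, d)" by (cases g)
  have e: "2 * p = a * p + b * r" "6 * q = a * q + b * w" "2 * r = c * p + d * r" "6 * w = c * q + d * w"
    using g(2) by (simp_all add: T gm gen10_def mult.commute)
  \<comment> \<open>Invariance of the trace under conjugation with the denominator cleared: the
    trace of \<open>g\<close> times the determinant of \<open>T\<close> is expressed by the entries
    of \<open>g T\<close>, hence by those of \<open>T gen10\<close>, and the result is 2 + 6 times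
    the determinant.\<close>
  have "(a + d) * (p * w - q * r) = (a * p + b * r) * w - (a * q + b * w) * r
      + (c * q + d * w) * p - (c * p + d * r) * q"
    by (simp add: algebra_simps)
  also have "\<dots> = 8 * (p * w - q * r)"
    unfolding e[symmetric] by (simp add: algebra_simps)
  finally have "a + d = 8" using det unfolding T mat_det.simps by (metis mult_right_cancel)
  then obtain s where s: "s \<in> icos" "mat_mult s g = mat_mult gen10 s"
    using gen10_conj[OF g(1) gm] by blast
  \<comment> \<open>\<open>R\<close> differs from \<open>T\<close> by an element of
    \<open>icos\<close>, so it has the same determinant and still normalizes \<open>icos\<close>,
    but commutes with \<open>gen10\<close>. The eigenvalues 2 and 6 are distinct, so
    \<open>R\<close> is diagonal.\<close>
  define R where "R = mat_mult s T"
  have RD: "mat_mult R gen10 = mat_mult gen10 R"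
    using g(2) s(2) by (metis R_def mat_mult_assoc)
  obtain p q r w where R: "R = (p, q, r, w)" by (cases R)
  have "(4 :: f11) * q = 6 * q - 2 * q" "(4 :: f11) * r = 6 * r - 2 * r" by (simp_all add: algebra_simps)
  moreover have "6 * q = 2 * q" "6 * r = 2 * r"
    using RD by (simp_all add: R gen10_def mult.commute)
  ultimately have "4 * q = 0" "4 * r = 0" by simp_all
  then have qr: "q = 0" "r = 0" by simp_all
  have detR: "mat_det R = mat_det T"
    by (simp add: R_def mat_det_mat_mult icos_det[OF s(1)])
  then have pw: "p \<noteq> 0" "w \<noteq> 0" using det by (auto simp: R qr)
  obtain s' where s': "s' \<in> icos" "mat_mult T gen4 = mat_mult s' T"
    using norm[OF gen4_icos] by blast
  \<comment> \<open>The conjugate of \<open>gen4\<close> by \<open>R\<close>.\<close>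
  define m where "m = mat_mult (mat_mult s s') (adj s)"
  have m: "m \<in> icos" unfolding m_def using s s' by (intro icos_mult icos_adj)
  have "mat_mult R gen4 = mat_mult m R"
    unfolding m_def R_def
    by (metis mat_mult_assoc mat_mult_adj(2) icos_det s(1) mat_mult_mat_one(1) s'(2))
  moreover obtain a b c d where mm: "m = (a, b, c, d)" by (cases m)
  \<comment> \<open>For diagonal \<open>R\<close> the entries of the conjugate give the diagonal (1,
    10) and make \<open>b\<close> the ratio of \<open>p\<close> to \<open>w\<close>. Thus the
    determinant \<open>p * w\<close> is \<open>b\<close> times a square, and
    \<open>icos_diag\<close> applies to \<open>b\<close>.\<close>
  ultimately have "p = a * p" "p = b * w" "10 * w = d * w"
    by (auto simp: R qr gen4_def mult.commute)
  then have "a = 1" "d = 10" and pb: "p = b * w" using pw by auto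
  then obtain t where "b = t * t"
    using icos_diag m mm by blast
  then have "mat_det T = (t * w) * (t * w)"
    using pb by (simp add: detR[symmetric] R qr algebra_simps)
  then show ?thesis by blast
qed

section \<open>Commuting matrices and scalars\<close>

definition scalar :: "mat \<Rightarrow> bool" where "scalar m \<longleftrightarrow> (\<exists>a. m = (a, 0, 0, a))"

text \<open>The three equations are the minors of the vectors \<open>(b, c, a - d)\<close> of the
  two matrices: commuting means that these vectors are linearly dependent.\<close>

lemma mat_mult_commute_iff:
  "mat_mult (a', b', c', d') (a, b, c, d) = mat_mult (a, b, c, d) (a', b', c', d') \<longleftrightarrow>
     b' * c = c' * b \<and> b' * (a - d) = b * (a' - d') \<and> c' * (a - d) = c * (a' - d')"
proof -
  have "mat_mult (a', b', c', d') (a, b, c, d) = mat_mult (a, b, c, d) (a', b', c', d') \<longleftrightarrow>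
      (a' * a + b' * c) - (a * a' + b * c') = 0 \<and> (a * b' + b * d') - (a' * b + b' * d) = 0 \<and>
      (c' * a + d' * c) - (c * a' + d * c') = 0 \<and> (c' * b + d' * d) - (c * b' + d * d') = 0"
    by (simp add: eq_commute[of "a * b' + b * d'"])
  also have "(a' * a + b' * c) - (a * a' + b * c') = b' * c - c' * b" by (simp add: mult.commute)
  also have "(a * b' + b * d') - (a' * b + b' * d) = b' * (a - d) - b * (a' - d')"
    by (simp add: algebra_simps)
  also have "(c' * a + d' * c) - (c * a' + d * c') = c' * (a - d) - c * (a' - d')"
    by (simp add: algebra_simps)
  also have "(c' * b + d' * d) - (c * b' + d * d') = - (b' * c - c' * b)"
    by (simp add: algebra_simps)
  finally show ?thesis by auto
qed

text \<open>The centralizer of a nonscalar matrix is commutative: both vectors in the sense of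
  \<open>mat_mult_commute_iff\<close> are proportional to that of \<open>h\<close>, which is
  nonzero, hence to each other.\<close>

lemma commute_trans:
  assumes "\<not> scalar h" "mat_mult x h = mat_mult h x" "mat_mult y h = mat_mult h y"
  shows "mat_mult x y = mat_mult y x"
proof -
  obtain a b c d where h: "h = (a, b, c, d)" by (cases h)
  obtain a1 b1 c1 d1 where x: "x = (a1, b1, c1, d1)" by (cases x)
  obtain a2 b2 c2 d2 where y: "y = (a2, b2, c2, d2)" by (cases y)
  have nz: "b \<noteq> 0 \<or> c \<noteq> 0 \<or> a - d \<noteq> 0"
    using assms(1) by (auto simp: h scalar_def)
  have x': "b1 * c = c1 * b" "b1 * (a - d) = b * (a1 - d1)" "c1 * (a - d) = c * (a1 - d1)"
    using assms(2) unfolding h x mat_mult_commute_iff by auto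
  have y': "b2 * c = c2 * b" "b2 * (a - d) = b * (a2 - d2)" "c2 * (a - d) = c * (a2 - d2)"
    using assms(3) unfolding h y mat_mult_commute_iff by auto
  define e where "e = a - d"
  define e1 where "e1 = a1 - d1"
  define e2 where "e2 = a2 - d2"
  note x'' = x'[folded e_def e1_def] and y'' = y'[folded e_def e2_def]
  \<comment> \<open>One coordinate of the vector of \<open>h\<close> is nonzero, so an identity may
    be proved after multiplication by each of the three coordinates.\<close>
  have cancel: "u = v" if "b * (u - v) = 0" "c * (u - v) = 0" "e * (u - v) = 0" for u v
    using nz that by (auto simp: e_def)
  have 1: "b1 * c2 = c1 * b2"
  proof (rule cancel)
    have "b * (b1 * c2 - c1 * b2) = b2 * (b1 * c - c1 * b) - b1 * (b2 * c - c2 * b)"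
      by (simp add: algebra_simps)
    then show "b * (b1 * c2 - c1 * b2) = 0"
      using x'' y'' by simp
    have "c * (b1 * c2 - c1 * b2) = c2 * (b1 * c - c1 * b) - c1 * (b2 * c - c2 * b)"
      by (simp add: algebra_simps)
    then show "c * (b1 * c2 - c1 * b2) = 0"
      using x'' y'' by simp
    have "e * (b1 * c2 - c1 * b2) = c2 * (b1 * e - b * e1) - b2 * (c1 * e - c * e1) - e1 * (b2 * c - c2 * b)"
      by (simp add: algebra_simps)
    then show "e * (b1 * c2 - c1 * b2) = 0"
      using x'' y'' by simp
  qed
  have 2: "b1 * e2 = b2 * e1"
  proof (rule cancel)
    have "b * (b1 * e2 - b2 * e1) = b2 * (b1 * e - b * e1) - b1 * (b2 * e - b * e2)"
      by (simp add: algebra_simps)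
    then show "b * (b1 * e2 - b2 * e1) = 0"
      using x'' y'' 1 by simp
    have "c * (b1 * e2 - b2 * e1) = b2 * (c1 * e - c * e1) - b1 * (c2 * e - c * e2) + e * (b1 * c2 - c1 * b2)"
      by (simp add: algebra_simps)
    then show "c * (b1 * e2 - b2 * e1) = 0"
      using x'' y'' 1 by simp
    have "e * (b1 * e2 - b2 * e1) = e2 * (b1 * e - b * e1) - e1 * (b2 * e - b * e2)"
      by (simp add: algebra_simps)
    then show "e * (b1 * e2 - b2 * e1) = 0"
      using x'' y'' 1 by simp
  qed
  have 3: "c1 * e2 = c2 * e1"
  proof (rule cancel)
    have "b * (c1 * e2 - c2 * e1) = c2 * (b1 * e - b * e1) - c1 * (b2 * e - b * e2) - e * (b1 * c2 - c1 * b2)"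
      by (simp add: algebra_simps)
    then show "b * (c1 * e2 - c2 * e1) = 0"
      using x'' y'' 1 by simp
    have "c * (c1 * e2 - c2 * e1) = c2 * (c1 * e - c * e1) - c1 * (c2 * e - c * e2)"
      by (simp add: algebra_simps)
    then show "c * (c1 * e2 - c2 * e1) = 0"
      using x'' y'' 1 by simp
    have "e * (c1 * e2 - c2 * e1) = e2 * (c1 * e - c * e1) - e1 * (c2 * e - c * e2)"
      by (simp add: algebra_simps)
    then show "e * (c1 * e2 - c2 * e1) = 0"
      using x'' y'' 1 by simp
  qed
  show ?thesis
    unfolding x y mat_mult_commute_iff e2_def[symmetric] e1_def[symmetric]
    using 1 2 3 by simp
qed

lemma scalar_det_1: "scalar m \<Longrightarrow> mat_det m = 1 \<Longrightarrow> m = mat_one \<or> m = mat_neg_one"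
  by (auto simp: scalar_def mat_one_def mat_neg_one_def square_eq_1_iff)

text \<open>Schur's lemma for the natural module, checked on the two generators:
  \<open>gen10\<close> has distinct eigenvalues, so \<open>m\<close> is diagonal, and
  \<open>gen4\<close> then forces equal diagonal entries.\<close>

lemma icos_center:
  assumes "\<And>s. s \<in> icos \<Longrightarrow> mat_mult m s = mat_mult s m"
  shows "scalar m"
proof -
  obtain a b c d where m: "m = (a, b, c, d)" by (cases m)
  have "6 * b = 2 * b" using assms[OF gen10_icos] by (simp add: m gen10_def mult.commute)
  then have "4 * b = 0" by (simp add: algebra_simps) 
  then have b: "b = 0" by simp
  have c: "c = 0" and "a = d"
    using assms[OF gen4_icos] by (simp_all add: m gen4_def b)
  then show ?thesis by (simp add: m b scalar_def)
qed

section \<open>Extensions of the Heisenberg group of order 1331\<close>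

lemma mat_vec_mat_mult: "mat_vec (mat_mult a b) v = mat_vec a (mat_vec b v)"
  by (cases a; cases b; cases v) (simp add: algebra_simps)

lemma mat_vec_mat_one [simp]: "mat_vec mat_one v = v"
  by (cases v) (simp add: mat_one_def)

lemma mat_vec_mat_neg_one [simp]: "mat_vec mat_neg_one v = - v"
  by (cases v) (simp add: mat_neg_one_def uminus_prod_def)

lemma mat_vec_add: "mat_vec a (v + w) = mat_vec a v + mat_vec a w"
  by (cases a; cases v; cases w) (simp add: algebra_simps)

lemma mat_vec_0 [simp]: "mat_vec a 0 = 0"
  by (cases a) (simp add: zero_prod_def)

lemma mat_vec_minus: "mat_vec a (- v) = - mat_vec a v"
  by (cases a; cases v) (simp add: uminus_prod_def)

lemma symp_add: "symp (v + v') w = symp v w + symp v' w" "symp v (w + w') = symp v w + symp v w'"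
  by (cases v; cases v'; cases w; cases w'; simp add: algebra_simps)+

lemma symp_0 [simp]: "symp 0 w = 0" "symp w 0 = 0"
  by (cases w; simp add: zero_prod_def)+

lemma symp_minus [simp]: "symp (- v) w = - symp v w" "symp v (- w) = - symp v w"
  by (cases v; cases w; simp add: uminus_prod_def)+

lemma symp_self [simp]: "symp v v = 0"
  by (cases v) simp

lemma symp_swap: "symp v w = - symp w v"
  by (cases v; cases w) simp

lemma symp_mat_vec: "symp (mat_vec a v) (mat_vec a w) = mat_det a * symp v w"
  by (cases a; cases v; cases w) (simp add: algebra_simps)

text \<open>
  An element \<open>(s, v, u)\<close> of \<open>aff\<close> stands for the product of the translation by \<open>(v, u)\<close> and \<open>s\<close>. The flag of
  \<open>affs\<close> decides whether the second module (the component \<open>u\<close>) is present. In \<open>Heis e b\<close> the first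
  module is extended to an extraspecial group whose commutator form is \<open>2 * e * symp\<close>.
\<close>

type_synonym aff = "mat \<times> vec \<times> vec"

fun amul :: "aff \<Rightarrow> aff \<Rightarrow> aff" where
  "amul (s, v, u) (s', v', u') = (mat_mult s s', v + mat_vec s v', u + mat_vec s u')"

definition aone :: aff where "aone = (mat_one, 0, 0)"

fun ainv :: "aff \<Rightarrow> aff" where
  "ainv (s, v, u) = (adj s, - mat_vec (adj s) v, - mat_vec (adj s) u)"

fun cocyc :: "aff \<Rightarrow> aff \<Rightarrow> f11" where
  "cocyc (s, v, u) (s', v', u') = symp v (mat_vec s v')"

definition affs :: "bool \<Rightarrow> aff set" where
  "affs b = {(s, v, u). s \<in> icos \<and> (b \<or> u = 0)}"

lemma affs_iff [simp]: "(s, v, u) \<in> affs b \<longleftrightarrow> s \<in> icos \<and> (b \<or> u = 0)"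
  by (simp add: affs_def)

lemma affsE:
  assumes "k \<in> affs b"
  obtains s v u where "k = (s, v, u)" "s \<in> icos" "mat_det s = 1" "b \<or> u = 0"
  using assms icos_det by (cases k) simp

lemma amul_closed: "k \<in> affs b \<Longrightarrow> l \<in> affs b \<Longrightarrow> amul k l \<in> affs b"
  by (elim affsE) (auto simp only: affs_iff amul.simps icos_mult mat_vec_0 add_0)

lemma aone_closed [simp]: "aone \<in> affs b"
  by (simp add: aone_def mat_one_icos)

lemma ainv_closed: "k \<in> affs b \<Longrightarrow> ainv k \<in> affs b"
  by (elim affsE) (auto simp only: affs_iff ainv.simps icos_adj mat_vec_0 minus_zero)

lemma amul_assoc: "amul (amul k l) m = amul k (amul l m)"
  by (cases k; cases l; cases m) (simp add: mat_mult_assoc mat_vec_add mat_vec_mat_mult add.assoc)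

lemma amul_aone [simp]: "amul aone k = k" "amul k aone = k"
  by (cases k; simp add: aone_def)+

lemma ainv_left: "k \<in> affs b \<Longrightarrow> amul (ainv k) k = aone"
  by (elim affsE) (simp add: aone_def mat_mult_adj)

lemma mat_vec_adj: "mat_det s = 1 \<Longrightarrow> mat_vec s (mat_vec (adj s) v) = v" "mat_det s = 1 \<Longrightarrow> mat_vec (adj s) (mat_vec s v) = v"
  by (simp_all add: mat_vec_mat_mult[symmetric] mat_mult_adj)

lemma ainv_amul: "k \<in> affs b \<Longrightarrow> l \<in> affs b \<Longrightarrow> ainv (amul k l) = amul (ainv l) (ainv k)"
  by (elim affsE) (simp add: adj_mat_mult mat_vec_mat_mult mat_vec_add mat_vec_adj mat_vec_minus)

lemma adj_adj [simp]: "adj (adj s) = s"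
  by (cases s) simp

lemma ainv_ainv: "k \<in> affs b \<Longrightarrow> ainv (ainv k) = k"
  by (elim affsE) (simp add: mat_vec_minus mat_vec_adj)

text \<open>The form is bilinear and invariant under linear parts of determinant 1, which gives the
  cocycle condition behind associativity.\<close>

lemma cocyc_identity:
  assumes "k \<in> affs b" "l \<in> affs b"
  shows "cocyc k l + cocyc (amul k l) m = cocyc k (amul l m) + cocyc l m"
  using assms
  by (elim affsE) (cases m, simp add: mat_vec_add symp_add mat_vec_mat_mult symp_mat_vec)

lemma cocyc_aone [simp]: "cocyc aone k = 0" "cocyc k aone = 0"
  by (cases k; simp add: aone_def)+

lemma cocyc_ainv: "k \<in> affs b \<Longrightarrow> cocyc k (ainv k) = 0" "k \<in> affs b \<Longrightarrow> cocyc (ainv k) k = 0"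
  by (elim affsE; simp add: mat_vec_minus mat_vec_adj)+

text \<open>Applying the linear part of \<open>k\<close> to both arguments of the form leaves its
  value unchanged and exposes the antisymmetry. This sign is what later turns an opposite group into
  a group with negated form.\<close>

lemma cocyc_ainv_ainv:
  assumes "k \<in> affs b" "l \<in> affs b'"
  shows "cocyc (ainv l) (ainv k) = - cocyc k l"
proof -
  obtain s v u s' v' u' where kl: "k = (s, v, u)" "l = (s', v', u')" by (cases k; cases l)
  have s: "s \<in> icos" "mat_det s = 1" "mat_det (adj s') = 1" using assms
    by (simp_all add: kl icos_det icos_adj)
  have "cocyc (ainv l) (ainv k) = symp v' (mat_vec (adj s) v)"
    using s(3) by (simp add: kl mat_vec_minus symp_mat_vec)
  also have "\<dots> = symp (mat_vec s v') (mat_vec s (mat_vec (adj s) v))"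
    by (simp add: symp_mat_vec s)
  also have "mat_vec s (mat_vec (adj s) v) = v"
    by (simp add: mat_vec_adj s)
  finally show ?thesis by (simp add: kl symp_swap[of v])
qed

definition Heis :: "f11 \<Rightarrow> bool \<Rightarrow> (f11 \<times> aff) monoid" where
  "Heis e b = \<lparr>carrier = UNIV \<times> affs b,
     monoid.mult = (\<lambda>(c, k) (c', k'). (c + c' + e * cocyc k k', amul k k')), one = (0, aone)\<rparr>"

lemma Heis_simps [simp]:
  "carrier (Heis e b) = UNIV \<times> affs b"
  "(c, k) \<otimes>\<^bsub>Heis e b\<^esub> (c', k') = (c + c' + e * cocyc k k', amul k k')"
  "\<one>\<^bsub>Heis e b\<^esub> = (0, aone)"
  by (simp_all add: Heis_def)

lemma group_Heis: "group (Heis e b)"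
proof (rule groupI)
  fix x y z assume "x \<in> carrier (Heis e b)" "y \<in> carrier (Heis e b)" "z \<in> carrier (Heis e b)"
  then obtain c k c' k' c'' k'' where
    xyz: "x = (c, k)" "y = (c', k')" "z = (c'', k'')" "k \<in> affs b" "k' \<in> affs b" "k'' \<in> affs b"
    by auto
  have "e * cocyc k k' + e * cocyc (amul k k') k'' = e * cocyc k (amul k' k'') + e * cocyc k' k''"
    using cocyc_identity[OF xyz(4) xyz(5)] by (metis distrib_left)
  then show "x \<otimes>\<^bsub>Heis e b\<^esub> y \<otimes>\<^bsub>Heis e b\<^esub> z = x \<otimes>\<^bsub>Heis e b\<^esub> (y \<otimes>\<^bsub>Heis e b\<^esub> z)"
    by (simp add: xyz amul_assoc algebra_simps)
next
  fix x assume "x \<in> carrier (Heis e b)"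
  then obtain c k where x: "x = (c, k)" "k \<in> affs b" by auto
  then have "(- c, ainv k) \<in> carrier (Heis e b)" "(- c, ainv k) \<otimes>\<^bsub>Heis e b\<^esub> x = \<one>\<^bsub>Heis e b\<^esub>"
    by (simp_all add: ainv_closed ainv_left cocyc_ainv)
  then show "\<exists>y\<in>carrier (Heis e b). y \<otimes>\<^bsub>Heis e b\<^esub> x = \<one>\<^bsub>Heis e b\<^esub>" by blast
next
  fix x y assume "x \<in> carrier (Heis e b)" "y \<in> carrier (Heis e b)"
  then show "x \<otimes>\<^bsub>Heis e b\<^esub> y \<in> carrier (Heis e b)"
    by (cases x; cases y) (simp only: Heis_simps amul_closed mem_Times_iff fst_conv snd_conv UNIV_I simp_thms)
next
  fix x assume "x \<in> carrier (Heis e b)"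
  then show "\<one>\<^bsub>Heis e b\<^esub> \<otimes>\<^bsub>Heis e b\<^esub> x = x"
    by (cases x) simp
qed simp

lemma inv_Heis:
  assumes "k \<in> affs b"
  shows "inv\<^bsub>Heis e b\<^esub> (c, k) = (- c, ainv k)"
proof -
  interpret group "Heis e b" by (rule group_Heis)
  show ?thesis
    by (rule inv_equality) (use assms in \<open>simp_all add: ainv_closed ainv_left cocyc_ainv\<close>)
qed

section \<open>Perfectness of the extensions\<close>

lemma two_f11: "(2 :: f11) \<noteq> 0" by simp

text \<open>Three layers of commutators: both generators of \<open>icos\<close> are commutators;
  commutators with -1 yield all translations up to the center, as 2 is invertible; commutators of
  translations yield the center, as \<open>2 * e\<close> is nonzero.\<close>

lemma perfect_Heis:
  assumes "e \<noteq> 0"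
  shows "perfect_group (Heis e b)"
proof -
  interpret group "Heis e b" by (rule group_Heis)
  let ?D = "derived (Heis e b) (carrier (Heis e b))"
  interpret D: subgroup ?D "Heis e b"
    by (rule derived_is_subgroup) simp
  have comm: "(c, k) \<otimes>\<^bsub>Heis e b\<^esub> (c', k') \<otimes>\<^bsub>Heis e b\<^esub> (- c, ainv k) \<otimes>\<^bsub>Heis e b\<^esub> (- c', ainv k') \<in> ?D"
    if "k \<in> affs b" "k' \<in> affs b" for c k c' k'
    using commutator_in_derived[of "(c, k)" "(c', k')"] that by (simp add: inv_Heis)
  have words: "(0, mat_mult (mat_mult (mat_mult s t) (adj s)) (adj t), 0, 0) \<in> ?D"
    if "s \<in> icos" "t \<in> icos" for s t
    using comm[of "(s, 0, 0)" "(t, 0, 0)" 0 0] that by (simp add: mat_vec_minus)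
  have s: "(0, s, 0, 0) \<in> ?D" if "s \<in> icos" for s
    using that
  proof (induction rule: icos_induct)
    case mat_one
    then show ?case using D.one_closed by (simp add: aone_def)
  next
    case (gen4 m)
    \<comment> \<open>An explicit pair of words with commutator \<open>gen4\<close>;
      \<open>gen10\<close> is treated likewise.\<close>
    have "gen4 = mat_mult (mat_mult (mat_mult (word [True, True, False, False, True, False])
        (word [False, False, True, False, True]))
        (adj (word [True, True, False, False, True, False])))
        (adj (word [False, False, True, False, True]))"
      by (simp add: word_eval)
    then have "(0, gen4, 0, 0) \<in> ?D" using words word_in_icos by metis
    from D.m_closed[OF this gen4(2)] show ?case by simp
  next
    case (gen10 m)
    have "gen10 = mat_mult (mat_mult (mat_mult (word [True, False, True, False]) (word [True, False, False]))
        (adj (word [True, False, True, False]))) (adj (word [True, False, False]))"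
      by (simp add: word_eval)
    then have "(0, gen10, 0, 0) \<in> ?D" using words word_in_icos by metis
    from D.m_closed[OF this gen10(2)] show ?case by simp
  qed
  \<comment> \<open>Halving is multiplication by 6, since 12 is 1 in the field. It preserves zero,
    so an absent second component stays absent.\<close>
  have five: "\<exists>w. w + w = v \<and> (v = 0 \<longrightarrow> w = 0)" for v :: vec
  proof (cases v)
    case (Pair x y)
    have "6 * z + 6 * z = z" for z :: f11
    proof -
      have "6 * z + 6 * z = 12 * z" by (simp add: algebra_simps)
      also have "(12 :: f11) = 1" by simp
      finally show ?thesis by simp
    qed
    then show ?thesis
      by (intro exI[of _ "(6 * x, 6 * y)"]) (simp add: Pair zero_prod_def)
  qed
  have v: "(0, mat_one, v, u) \<in> ?D" if bu: "b \<or> u = 0" for v u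
  proof -
    obtain v' u' where w: "v' + v' = v" "u' + u' = u" "b \<or> u' = 0"
      using five[of v] five[of u] bu by metis
    have n: "adj mat_neg_one = mat_neg_one" "mat_mult mat_neg_one mat_neg_one = mat_one" "adj mat_one = mat_one" by (simp_all add: mat_neg_one_def mat_one_def)
    \<comment> \<open>The commutator of -1 with a translation is the translation by minus twice the
      vector.\<close>
    have "(0, mat_one, - v, - u) \<in> ?D"
      using comm[of "(mat_neg_one, 0, 0)" "(mat_one, v', u')" 0 0] w(3)
      by (simp add: mat_neg_one_icos mat_one_icos n w(1,2)[symmetric])
    from D.m_inv_closed[OF this] show ?thesis
      using bu by (simp add: inv_Heis mat_one_icos n(3))
  qed
  have c: "(c, aone) \<in> ?D" for c
  proof -
    obtain d where d: "2 * (e * d) = c"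
    proof -
      have "inj ((*) (2 * e))" using assms by (auto simp: inj_on_def)
      then have "surj ((*) (2 * e))" by (intro finite_UNIV_inj_surj) auto
      then obtain d where "c = 2 * e * d" by (rule surjE)
      then show ?thesis using that[of d] by (simp only: mult.assoc)
    qed
    \<comment> \<open>The form takes the value \<open>d\<close> on this pair, so their translations
      have the commutator \<open>2 * (e * d)\<close> in the center.\<close>
    define x :: vec where "x = (1, 0)"
    define y :: vec where "y = (0, d)"
    have xy: "symp x y = d" by (simp add: x_def y_def)
    have yx: "symp y x = - d" by (simp add: x_def y_def)
    have n: "adj mat_one = mat_one" by (simp add: mat_one_def)
    have "(e * d + e * d, mat_one, 0, 0) \<in> ?D"
      using comm[of "(mat_one, x, 0)" "(mat_one, y, 0)" 0 0]
      by (simp add: mat_one_icos n symp_add xy yx)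
    then show ?thesis by (simp only: d[symmetric] aone_def mult_2)
  qed
  have "(c, k) \<in> ?D" if k: "k \<in> affs b" for c k
  proof -
    obtain t w u where t: "k = (t, w, u)" "t \<in> icos" "b \<or> u = 0" using k by (rule affsE)
    from D.m_closed[OF c[of c] D.m_closed[OF v[OF t(3), of w] s[OF t(2)]]]
    show ?thesis by (simp add: t(1))
  qed
  then have "carrier (Heis e b) \<subseteq> ?D" by auto
  then show ?thesis unfolding perfect_group_def using group_Heis D.subset by blast
qed

section \<open>Central indecomposability of the extensions\<close>

lemma Heis_commute:
  assumes "(c, s, v, u) \<otimes>\<^bsub>Heis e b\<^esub> (c', s', v', u') = (c', s', v', u') \<otimes>\<^bsub>Heis e b\<^esub> (c, s, v, u)"
  shows "mat_mult s s' = mat_mult s' s" "v + mat_vec s v' = v' + mat_vec s' v" "u + mat_vec s u' = u' + mat_vec s' u"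
  using assms by simp_all

lemma vec_double_0: "v + v = 0 \<Longrightarrow> v = (0 :: vec)"
proof (cases v)
  case (Pair x y)
  assume "v + v = 0"
  then have "2 * x = 0" "2 * y = 0"
    unfolding Pair zero_prod_def mult_2 by simp_all
  then show "v = 0" by (simp add: Pair zero_prod_def)
qed

lemma mat_one_neq_mat_neg_one: "mat_one \<noteq> mat_neg_one" by (simp add: mat_one_def mat_neg_one_def)

text \<open>Up to sign \<open>s\<close> is \<open>gen10\<close>, and 1 is not among the eigenvalues
  2, 6, -2, -6.\<close>

lemma gen10_no_fixed_vector:
  assumes "mat_mult s k = gen10" "k = mat_one \<or> k = mat_neg_one" "mat_vec s v = v"
  shows "v = 0"
proof -
  obtain x y where v: "v = (x, y)" by (cases v)
  have "mat_mult mat_neg_one mat_neg_one = mat_one" by (simp add: mat_neg_one_def mat_one_def)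
  then have "s = gen10 \<or> s = mat_mult gen10 mat_neg_one"
    using assms(1,2) by (metis mat_mult_assoc mat_mult_mat_one(2))
  then have "((2 - 1) * x = 0 \<and> (6 - 1) * y = 0) \<or> ((- 2 - 1) * x = 0 \<and> (- 6 - 1) * y = 0)"
    using assms(3) unfolding v by (auto simp: gen10_def mat_neg_one_def algebra_simps)
  then show "v = 0" by (auto simp: v zero_prod_def)
qed

text \<open>The linear parts occurring in \<open>K\<close> are 1 and -1. The first kind is shown to
  be central and the second kind impossible, so \<open>K\<close> is central and
  \<open>perfect_central_factor\<close> applies.\<close>

lemma Heis_scalar_factor:
  assumes e: "e \<noteq> 0"
    and H: "subgroup H (Heis e b)" and K: "subgroup K (Heis e b)"
    and HK: "carrier (Heis e b) = H <#>\<^bsub>Heis e b\<^esub> K"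
    and comm: "\<And>h k. h \<in> H \<Longrightarrow> k \<in> K \<Longrightarrow> h \<otimes>\<^bsub>Heis e b\<^esub> k = k \<otimes>\<^bsub>Heis e b\<^esub> h"
    and sc: "\<And>c s v u. (c, s, v, u) \<in> K \<Longrightarrow> scalar s"
  shows "H = carrier (Heis e b)"
proof -
  let ?G = "Heis e b"
  interpret group ?G by (rule group_Heis)
  interpret H: subgroup H ?G by (rule H)
  interpret K: subgroup K ?G by (rule K)
  have Kcar: "s \<in> icos \<and> (b \<or> u = 0) \<and> (s = mat_one \<or> s = mat_neg_one)" if "(c, s, v, u) \<in> K" for c s v u
    using K.mem_carrier[OF that] sc[OF that] scalar_det_1 icos_det by auto
  have dec: "\<exists>h\<in>H. \<exists>k\<in>K. x = h \<otimes>\<^bsub>?G\<^esub> k" if "x \<in> carrier ?G" for x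
    using that unfolding HK by (auto simp: set_mult_def)
  obtain h k where hk: "h \<in> H" "k \<in> K" "(0, gen10, 0, 0) = h \<otimes>\<^bsub>?G\<^esub> k"
    using dec[of "(0, gen10, 0, 0)"] by (auto simp: gen10_icos)
  obtain c0 s0 v0 u0 where h0: "h = (c0, s0, v0, u0)" by (cases h)
  obtain c1 s1 v1 u1 where k0: "k = (c1, s1, v1, u1)" by (cases k)
  have ms: "mat_mult s0 s1 = gen10" "s1 = mat_one \<or> s1 = mat_neg_one"
    using hk(3) Kcar hk(2) by (auto simp: h0 k0 simp del: mat_mult.simps)
  \<comment> \<open>\<open>h\<close> has linear part \<open>gen10\<close> up to sign and commutes
    with \<open>K\<close>, so it fixes the vectors of any translation in \<open>K\<close>, which
    must vanish.\<close>
  have P: "v = 0 \<and> u = 0" if "(c, mat_one, v, u) \<in> K" for c v u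
  proof -
    have "mat_vec s0 v = v" "mat_vec s0 u = u"
      using Heis_commute[OF comm[OF hk(1)[unfolded h0] that]] by (simp_all add: add.commute)
    then show ?thesis using gen10_no_fixed_vector[OF ms] by blast
  qed
  have N: "False" if k: "(c, mat_neg_one, v, u) \<in> K" for c v u
  proof -
    define w :: vec where "w = (1, 0)"
    have "(0, mat_one, w, 0) \<in> carrier ?G" by (simp add: mat_one_icos)
    then obtain h' k' where hk': "h' \<in> H" "k' \<in> K" "(0, mat_one, w, 0) = h' \<otimes>\<^bsub>?G\<^esub> k'"
      using dec by blast
    have cc: "h' \<in> carrier ?G" "k' \<in> carrier ?G" "(c, mat_neg_one, v, u) \<in> carrier ?G"
      using hk' k H.mem_carrier K.mem_carrier by blast+
    obtain c2 s2 v2 u2 where k': "k' = (c2, s2, v2, u2)" by (cases k')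
    define q where "q = (c, mat_neg_one, v, u)"
    \<comment> \<open>The commutator of \<open>q\<close> and \<open>k'\<close>. Its linear part is
      trivial because that of \<open>q\<close> is scalar, so it is central by
      \<open>P\<close>.\<close>
    define d where "d = (q \<otimes>\<^bsub>?G\<^esub> k') \<otimes>\<^bsub>?G\<^esub> inv\<^bsub>?G\<^esub> (k' \<otimes>\<^bsub>?G\<^esub> q)"
    have qK: "q \<in> K" using k by (simp add: q_def)
    have dK: "d \<in> K" unfolding d_def using qK hk'(2) by blast
    have qk: "q \<otimes>\<^bsub>?G\<^esub> k' = d \<otimes>\<^bsub>?G\<^esub> (k' \<otimes>\<^bsub>?G\<^esub> q)"
      unfolding d_def using qK hk'(2) K.mem_carrier by (simp add: m_assoc del: Heis_simps)
    obtain c3 s3 v3 u3 where d: "d = (c3, s3, v3, u3)" by (cases d)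
    have "mat_mult mat_neg_one s2 = mat_mult s2 mat_neg_one" by (cases s2) (simp add: mat_neg_one_def)
    then have "mat_mult s2 mat_neg_one = mat_mult s3 (mat_mult s2 mat_neg_one)"
      using qk by (simp add: q_def k' d)
    then have "mat_mult (mat_mult s2 mat_neg_one) (adj (mat_mult s2 mat_neg_one)) = mat_mult s3 (mat_mult (mat_mult s2 mat_neg_one) (adj (mat_mult s2 mat_neg_one)))"
      by (metis mat_mult_assoc)
    moreover have "mat_det (mat_mult s2 mat_neg_one) = 1"
      using Kcar hk'(2) mat_neg_one_icos icos_mult icos_det unfolding k' by metis
    ultimately have "s3 = mat_one" by (simp add: mat_mult_adj)
    then have d': "d = (c3, aone)" using P dK unfolding d by (auto simp: aone_def)
    have zc: "d \<otimes>\<^bsub>?G\<^esub> x = x \<otimes>\<^bsub>?G\<^esub> d" for x unfolding d' by (cases x) (simp add: add.commute)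
    have "q \<otimes>\<^bsub>?G\<^esub> (h' \<otimes>\<^bsub>?G\<^esub> k') = h' \<otimes>\<^bsub>?G\<^esub> (q \<otimes>\<^bsub>?G\<^esub> k')"
      using comm[OF hk'(1) qK] cc unfolding q_def by (simp add: m_assoc[symmetric] del: Heis_simps)
    also have "\<dots> = d \<otimes>\<^bsub>?G\<^esub> ((h' \<otimes>\<^bsub>?G\<^esub> k') \<otimes>\<^bsub>?G\<^esub> q)"
      unfolding qk using zc[of h'] cc qK dK K.mem_carrier
      by (simp add: m_assoc[symmetric] del: Heis_simps)
    \<comment> \<open>Modulo the center \<open>q\<close> commutes with the translation by
      \<open>w\<close>, whereas its linear part -1 inverts that translation.\<close>
    finally have "v - w = w + v"
      unfolding hk'(3)[symmetric] q_def d' by simp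
    then have "w + w = 0" by (simp add: algebra_simps)
    then have "w = 0" by (rule vec_double_0)
    then show False by (simp add: w_def zero_prod_def)
  qed
  have "\<exists>c. k = (c, aone)" if "k \<in> K" for k
    using that P N Kcar by (cases k) (fastforce simp: aone_def)
  then have "k \<otimes>\<^bsub>?G\<^esub> x = x \<otimes>\<^bsub>?G\<^esub> k" if "k \<in> K" for k x
    using that by (cases x) (fastforce simp: add.commute)
  moreover have "derived ?G (carrier ?G) = carrier ?G"
    using perfect_Heis[OF e] by (simp add: perfect_group_def)
  ultimately show ?thesis
    using perfect_central_factor[OF _ H HK K.subset] by blast
qed

text \<open>Otherwise both factors contain nonscalar linear parts, \<open>s\<close> in
  \<open>K\<close> and \<open>s'\<close> in \<open>H\<close>. Any linear part from \<open>H\<close>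
  commutes with \<open>s\<close>; one from \<open>K\<close> commutes with \<open>s'\<close>, as does
  \<open>s\<close>, hence with \<open>s\<close> by \<open>commute_trans\<close>. So \<open>s\<close>
  centralizes all of \<open>icos\<close> and is scalar.\<close>

lemma Heis_indecomposable:
  assumes e: "e \<noteq> 0"
  shows "centrally_indecomposable (Heis e b)"
proof -
  let ?G = "Heis e b"
  interpret group ?G by (rule group_Heis)
  have "False" if ss: "H \<subset> carrier ?G" "K \<subset> carrier ?G" and cp: "central_product ?G [H, K]" for H K
  proof -
    have H: "subgroup H ?G" and K: "subgroup K ?G" and HK: "carrier ?G = H <#>\<^bsub>?G\<^esub> K"
      and comm: "\<And>h k. h \<in> H \<Longrightarrow> k \<in> K \<Longrightarrow> h \<otimes>\<^bsub>?G\<^esub> k = k \<otimes>\<^bsub>?G\<^esub> h"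
      using cp unfolding central_product_pair_iff by blast+
    have KH: "carrier ?G = K <#>\<^bsub>?G\<^esub> H"
      unfolding HK by (rule set_mult_commute) (rule comm)
    obtain c s v u where k: "(c, s, v, u) \<in> K" "\<not> scalar s"
      using Heis_scalar_factor[OF e H K HK comm] ss by blast
    obtain c' s' v' u' where h: "(c', s', v', u') \<in> H" "\<not> scalar s'"
      using Heis_scalar_factor[OF e K H KH comm[symmetric]] ss by blast
    have HS: "mat_mult x s = mat_mult s x" if "(d, x, y, z) \<in> H" for d x y z
      using Heis_commute(1)[OF comm[OF that k(1)]] .
    have KS: "mat_mult x s' = mat_mult s' x" if "(d, x, y, z) \<in> K" for d x y z
      using Heis_commute(1)[OF comm[OF h(1) that]] by simp
    have "mat_mult s t = mat_mult t s" if "t \<in> icos" for t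
    proof -
      have "(0, t, 0, 0) \<in> H <#>\<^bsub>?G\<^esub> K" using that unfolding HK[symmetric] by simp
      then obtain d x y z d' x' y' z' where
        xx: "(d, x, y, z) \<in> H" "(d', x', y', z') \<in> K" "t = mat_mult x x'"
        by (auto simp: set_mult_def simp del: mat_mult.simps)
      have "mat_mult x' s = mat_mult s x'"
        by (rule commute_trans[OF h(2) KS[OF xx(2)] KS[OF k(1)]])
      then show ?thesis using HS[OF xx(1)] unfolding xx(3) by (metis mat_mult_assoc)
    qed
    then show False using icos_center k(2) by blast
  qed
  moreover have "(1, aone) \<in> carrier ?G" "(1, aone) \<noteq> \<one>\<^bsub>?G\<^esub>" by simp_all
  ultimately show ?thesis
    unfolding centrally_indecomposable_def using perfect_Heis[OF e] by blast
qed

text \<open>Commuting with -1 kills the vectors, and commuting with all translations of the first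
  module then makes the linear part trivial.\<close>

lemma Heis_center:
  assumes x: "x \<in> carrier (Heis e b)"
    and c: "\<And>y. y \<in> carrier (Heis e b) \<Longrightarrow> x \<otimes>\<^bsub>Heis e b\<^esub> y = y \<otimes>\<^bsub>Heis e b\<^esub> x"
  shows "\<exists>a. x = (a, aone)"
proof -
  obtain a s v u where xx: "x = (a, s, v, u)" "s \<in> icos" by (cases x) (use x in auto)
  note comm = Heis_commute[OF c[unfolded xx(1)]]
  have N: "(0, mat_neg_one, 0, 0) \<in> carrier (Heis e b)" by (simp add: mat_neg_one_icos)
  have "v = - v" "u = - u"
    using comm(2,3)[OF N] unfolding mat_vec_0 mat_vec_mat_neg_one add_0_left add_0_right .
  then have "v + v = 0" "u + u = 0"
    unfolding add_eq_0_iff .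
  note vu = this[THEN vec_double_0]
  have sv: "mat_vec s w = w" for w
  proof -
    have "(0, mat_one, w, 0) \<in> carrier (Heis e b)" by (simp add: mat_one_icos)
    from comm(2)[OF this] show ?thesis by (simp add: vu)
  qed
  obtain p q r t where s: "s = (p, q, r, t)" by (cases s)
  have "s = mat_one" using sv[of "(1, 0)"] sv[of "(0, 1)"] by (simp add: s mat_one_def)
  then show ?thesis by (simp add: xx vu aone_def)
qed

section \<open>Isomorphisms between the extensions\<close>

lemma mat_eqI:
  assumes "\<And>v. mat_vec a v = mat_vec b v" shows "a = b"
  using assms[of "(1, 0)"] assms[of "(0, 1)"] by (cases a; cases b) simp

lemma Heis_pow_linear_part:
  "fst (snd (x [^]\<^bsub>Heis e b\<^esub> (n::nat))) = mat_pow (fst (snd x)) n"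
proof (induction n)
  case 0
  then show ?case by (simp add: nat_pow_def aone_def)
next
  case (Suc n)
  obtain a s v u where x: "x = (a, s, v, u)" by (cases x)
  obtain a' s' v' u' where xn: "x [^]\<^bsub>Heis e b\<^esub> n = (a', s', v', u')"
    by (cases "x [^]\<^bsub>Heis e b\<^esub> n")
  have "x [^]\<^bsub>Heis e b\<^esub> Suc n = x [^]\<^bsub>Heis e b\<^esub> n \<otimes>\<^bsub>Heis e b\<^esub> x"
    by (simp add: nat_pow_def)
  then show ?case using Suc unfolding xn unfolding x by simp
qed

lemma Heis_translation_pow:
  "(0, mat_one, (x, y), 0) [^]\<^bsub>Heis e b\<^esub> (n::nat) = (0, mat_one, (of_nat n * x, of_nat n * y), 0)"
proof (induction n)
  case 0
  then show ?case by (simp add: nat_pow_def aone_def zero_prod_def)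
next
  case (Suc n)
  have "(0, mat_one, (x, y), 0) [^]\<^bsub>Heis e b\<^esub> Suc n
      = (0, mat_one, (x, y), 0) [^]\<^bsub>Heis e b\<^esub> n \<otimes>\<^bsub>Heis e b\<^esub> (0, mat_one, (x, y), 0)"
    by (simp add: nat_pow_def)
  then show ?case using Suc by (simp add: algebra_simps)
qed

text \<open>
  The translations are singled out as the elements of order dividing 11, so an isomorphism induces a
  matrix normalizing \<open>icos\<close> on the first module. It multiplies \<open>symp\<close> by its determinant, a square.
\<close>

lemma Heis_iso_multiplier:
  assumes e: "e \<noteq> 0" "e' \<noteq> 0" and th: "th \<in> iso (Heis e b) (Heis e' b')"
  shows "\<exists>\<mu> t. t \<noteq> 0 \<and> e * \<mu> = e' * (t * t) \<and> (\<forall>c. th (c, aone) = (c * \<mu>, aone))"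
proof -
  let ?G = "Heis e b" and ?H = "Heis e' b'"
  interpret G: group ?G by (rule group_Heis)
  interpret H: group ?H by (rule group_Heis)
  have hom: "th \<in> hom ?G ?H" and bij: "bij_betw th (carrier ?G) (carrier ?H)"
    using th by (auto simp: iso_def)
  interpret group_hom ?G ?H th by unfold_locales (rule hom)
  have mult: "th (x \<otimes>\<^bsub>?G\<^esub> y) = th x \<otimes>\<^bsub>?H\<^esub> th y" if "x \<in> carrier ?G" "y \<in> carrier ?G" for x y
    using that by (rule hom_mult)
  define m where "m c = fst (th (c, aone))" for c
  have m: "th (c, aone) = (m c, aone)" for c
  proof -
    have "\<exists>a. th (c, aone) = (a, aone)"
    proof (rule Heis_center)
      show "th (c, aone) \<in> carrier ?H" by (rule hom_closed) simp
      fix y assume "y \<in> carrier ?H"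
      then obtain x where x: "x \<in> carrier ?G" "y = th x"
        using bij unfolding bij_betw_def by blast
      have "(c, aone) \<otimes>\<^bsub>?G\<^esub> x = x \<otimes>\<^bsub>?G\<^esub> (c, aone)"
        by (cases x) (simp add: add.commute)
      then show "th (c, aone) \<otimes>\<^bsub>?H\<^esub> y = y \<otimes>\<^bsub>?H\<^esub> th (c, aone)"
        using mult[of "(c, aone)" x] mult[of x "(c, aone)"] x by simp
    qed
    then show ?thesis by (auto simp: m_def)
  qed
  have madd: "m (c + d) = m c + m d" for c d
    using mult[of "(c, aone)" "(d, aone)"] by (simp add: m)
  have mlin: "m c = c * m 1" for c
    using madd by (rule f11_additive)
  have m1: "m 1 \<noteq> 0"
  proof
    assume "m 1 = 0"
    then have "th (1, aone) = th (0, aone)" using mlin[of 0] by (simp add: m)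
    then have "(1 :: f11, aone) = (0, aone)"
      by (rule inj_onD[OF bij_betw_imp_inj_on[OF bij]]) simp_all
    then show False by simp
  qed
  have car: "(0, mat_one, v, 0) \<in> carrier ?G" for v by (simp add: mat_one_icos)
  \<comment> \<open>The action on the first module. The image of a translation has order dividing
    11, hence trivial linear part by \<open>icos_order_11\<close>; a component in the second module
    may occur and is ignored by \<open>T\<close>.\<close>
  define T where "T v = fst (snd (snd (th (0, mat_one, v, 0))))" for v
  have T: "\<exists>a u. th (0, mat_one, v, 0) = (a, mat_one, T v, u)" for v
  proof -
    obtain a s w u where t: "th (0, mat_one, v, 0) = (a, s, w, u)" by (cases "th (0, mat_one, v, 0)")
    have "(a, s, w, u) \<in> carrier ?H" using hom_closed[OF car[of v]] t by simp
    then have s: "s \<in> icos" by simp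
    obtain x y where v: "v = (x, y)" by (cases v)
    have "(0, mat_one, v, 0) [^]\<^bsub>?G\<^esub> (11::nat) = \<one>\<^bsub>?G\<^esub>"
      unfolding v Heis_translation_pow f11_eleven by (simp add: aone_def zero_prod_def)
    then have "(a, s, w, u) [^]\<^bsub>?H\<^esub> (11::nat) = \<one>\<^bsub>?H\<^esub>"
      using hom_nat_pow[OF car[of v], of 11] hom_one t by simp
    then have "mat_pow s 11 = mat_one"
      using Heis_pow_linear_part[of e' b' "(a, s, w, u)" 11] by (simp add: aone_def)
    then have "s = mat_one" using icos_order_11 s by blast
    then show ?thesis using t by (auto simp: T_def)
  qed
  \<comment> \<open>Translations of the first module multiply additively up to a central element,
    and \<open>th\<close> maps the center to the center.\<close>
  have Tadd: "T (v + w) = T v + T w" for v w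
  proof -
    have "(0, mat_one, v, 0) \<otimes>\<^bsub>?G\<^esub> (0, mat_one, w, 0) = (e * symp v w, aone) \<otimes>\<^bsub>?G\<^esub> (0, mat_one, v + w, 0)"
      by (simp add: aone_def)
    then have "th (0, mat_one, v, 0) \<otimes>\<^bsub>?H\<^esub> th (0, mat_one, w, 0)
        = (m (e * symp v w), aone) \<otimes>\<^bsub>?H\<^esub> th (0, mat_one, v + w, 0)"
      using mult[OF car[of v] car[of w]] mult[OF _ car[of "v + w"], of "(e * symp v w, aone)"]
      by (simp add: m)
    then show ?thesis using T[of v] T[of w] T[of "v + w"] by (auto simp: aone_def)
  qed
  \<comment> \<open>Comparison of commutators of translations, which are \<open>2 * e * symp\<close>
    in the source and \<open>2 * e' * symp\<close> in the target.\<close>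
  have Tom: "e' * symp (T v) (T w) = e * m 1 * symp v w" for v w
  proof -
    have "(0, mat_one, v, 0) \<otimes>\<^bsub>?G\<^esub> (0, mat_one, w, 0)
        = (e * symp v w + e * symp v w, aone) \<otimes>\<^bsub>?G\<^esub> ((0, mat_one, w, 0) \<otimes>\<^bsub>?G\<^esub> (0, mat_one, v, 0))"
      by (simp add: aone_def symp_swap[of w v] add.commute)
    then have "th (0, mat_one, v, 0) \<otimes>\<^bsub>?H\<^esub> th (0, mat_one, w, 0)
        = (m (e * symp v w + e * symp v w), aone) \<otimes>\<^bsub>?H\<^esub> (th (0, mat_one, w, 0) \<otimes>\<^bsub>?H\<^esub> th (0, mat_one, v, 0))"
      using mult[OF car[of v] car[of w]] mult[OF car[of w] car[of v]]
        mult[of "(e * symp v w + e * symp v w, aone)" "(0, mat_one, w, 0) \<otimes>\<^bsub>?G\<^esub> (0, mat_one, v, 0)"]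
        G.m_closed[OF car[of w] car[of v]]
      by (simp add: m del: Heis_simps(2))
    then have "e' * symp (T v) (T w) = m (e * symp v w + e * symp v w) + e' * symp (T w) (T v)"
      using T[of v] T[of w] by (auto simp: aone_def algebra_simps)
    then have "e' * symp (T v) (T w) = (e * symp v w + e * symp v w) * m 1 - e' * symp (T v) (T w)"
      unfolding symp_swap[of "T w" "T v"] mlin[of "e * symp v w + e * symp v w"] by simp
    then have "2 * (e' * symp (T v) (T w)) = 2 * (e * m 1 * symp v w)"
      unfolding eq_diff_eq mult_2 by (simp only: distrib_right mult.assoc mult.commute[of "m 1"])
    then show ?thesis using two_f11 by (metis mult_left_cancel)
  qed
  obtain p r where T1: "T (1, 0) = (p, r)" by (cases "T (1, 0)")
  obtain q w where T2: "T (0, 1) = (q, w)" by (cases "T (0, 1)")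
  define M where "M = (p, q, r, w)"
  have Tmv: "T v = mat_vec M v" for v
  proof -
    obtain x y where v: "v = (x, y)" by (cases v)
    have x: "T (x, 0) = (x * p, x * r)"
    proof -
      have "fst (T (x, 0)) = x * fst (T (1, 0))"
        by (rule f11_additive[of "\<lambda>x. fst (T (x, 0))"]) (simp flip: Tadd fst_add)
      moreover have "snd (T (x, 0)) = x * snd (T (1, 0))"
        by (rule f11_additive[of "\<lambda>x. snd (T (x, 0))"]) (simp flip: Tadd snd_add)
      ultimately show ?thesis by (simp add: T1 prod_eq_iff)
    qed
    have y: "T (0, y) = (y * q, y * w)"
    proof -
      have "fst (T (0, y)) = y * fst (T (0, 1))"
        by (rule f11_additive[of "\<lambda>x. fst (T (0, x))"]) (simp flip: Tadd fst_add)
      moreover have "snd (T (0, y)) = y * snd (T (0, 1))"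
        by (rule f11_additive[of "\<lambda>x. snd (T (0, x))"]) (simp flip: Tadd snd_add)
      ultimately show ?thesis by (simp add: T2 prod_eq_iff)
    qed
    have "T v = T (x, 0) + T (0, y)" by (simp add: v flip: Tadd)
    then show ?thesis by (simp add: x y v M_def mult.commute)
  qed
  \<comment> \<open>The form is 1 on the standard basis, and its value on the images is the
    determinant of \<open>M\<close>.\<close>
  have det: "e' * mat_det M = e * m 1"
    using Tom[of "(1, 0)" "(0, 1)"] by (simp add: T1 T2 M_def mult.commute)
  then have det0: "mat_det M \<noteq> 0" using e m1 by auto
  have "\<exists>s'\<in>icos. mat_mult M s = mat_mult s' M" if s: "s \<in> icos" for s
  proof -
    obtain a s' v' u' where t: "th (0, s, 0, 0) = (a, s', v', u')" by (cases "th (0, s, 0, 0)")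
    have sc: "(0, s, 0, 0) \<in> carrier ?G" using s by simp
    have "(a, s', v', u') \<in> carrier ?H" using hom_closed[OF sc] t by simp
    then have s': "s' \<in> icos" by simp
    have "mat_vec (mat_mult M s) v = mat_vec (mat_mult s' M) v" for v
    proof -
      \<comment> \<open>Applying \<open>th\<close> to the conjugation action of \<open>s\<close> on
        translations shows that \<open>M\<close> intertwines \<open>s\<close> with the linear part
        \<open>s'\<close> of its image.\<close>
      have "(0, s, 0, 0) \<otimes>\<^bsub>?G\<^esub> (0, mat_one, v, 0) = (0, mat_one, mat_vec s v, 0) \<otimes>\<^bsub>?G\<^esub> (0, s, 0, 0)"
        by simp
      then have "th (0, s, 0, 0) \<otimes>\<^bsub>?H\<^esub> th (0, mat_one, v, 0) = th (0, mat_one, mat_vec s v, 0) \<otimes>\<^bsub>?H\<^esub> th (0, s, 0, 0)"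
        using mult[OF sc car[of v]] mult[OF car[of "mat_vec s v"] sc] by simp
      then have "mat_vec s' (T v) = T (mat_vec s v)"
        using T[of v] T[of "mat_vec s v"] unfolding t by (auto simp: add.commute)
      then show ?thesis by (simp add: Tmv mat_vec_mat_mult)
    qed
    then show ?thesis using s' mat_eqI by blast
  qed
  then obtain t where t: "mat_det M = t * t"
    using icos_normalizer_det[OF det0] by blast
  then have "t \<noteq> 0" "e * m 1 = e' * (t * t)" using det0 det by auto
  then show ?thesis using m mlin by metis
qed

section \<open>The central product\<close>

text \<open>The amalgam of \<open>Heis 1 False\<close>, \<open>Heis (-1) False\<close> and
  \<open>Heis 1 True\<close>: identifying the centers leaves a single central coordinate, on which
  the three signed cocycles add up.\<close>

definition Tri :: "(f11 \<times> aff \<times> aff \<times> aff) monoid" where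
  "Tri = \<lparr>carrier = UNIV \<times> affs False \<times> affs False \<times> affs True,
     monoid.mult = (\<lambda>(c, k1, k2, k3) (c', l1, l2, l3).
       (c + c' + cocyc k1 l1 - cocyc k2 l2 + cocyc k3 l3, amul k1 l1, amul k2 l2, amul k3 l3)),
     one = (0, aone, aone, aone)\<rparr>"

lemma Tri_simps [simp]:
  "carrier Tri = UNIV \<times> affs False \<times> affs False \<times> affs True"
  "(c, k1, k2, k3) \<otimes>\<^bsub>Tri\<^esub> (c', l1, l2, l3) =
     (c + c' + cocyc k1 l1 - cocyc k2 l2 + cocyc k3 l3, amul k1 l1, amul k2 l2, amul k3 l3)"
  "\<one>\<^bsub>Tri\<^esub> = (0, aone, aone, aone)"
  by (simp_all add: Tri_def)

lemma ainv_aone [simp]: "ainv aone = aone"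
  by (simp add: aone_def mat_one_def)

lemma group_Tri: "group Tri"
proof (rule groupI)
  fix x y z assume "x \<in> carrier Tri" "y \<in> carrier Tri" "z \<in> carrier Tri"
  then obtain c k1 k2 k3 c' l1 l2 l3 c'' m1 m2 m3 where
    xyz: "x = (c, k1, k2, k3)" "y = (c', l1, l2, l3)" "z = (c'', m1, m2, m3)"
    and k: "k1 \<in> affs False" "k2 \<in> affs False" "k3 \<in> affs True"
      "l1 \<in> affs False" "l2 \<in> affs False" "l3 \<in> affs True"
    by auto
  have cocycle: "cocyc (amul k l) m = cocyc k (amul l m) + cocyc l m - cocyc k l"
    if "k \<in> affs b" "l \<in> affs b" for k l m b
    using cocyc_identity[OF that, of m] by (simp add: eq_diff_eq add.commute)
  show "x \<otimes>\<^bsub>Tri\<^esub> y \<otimes>\<^bsub>Tri\<^esub> z = x \<otimes>\<^bsub>Tri\<^esub> (y \<otimes>\<^bsub>Tri\<^esub> z)"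
    by (simp add: xyz amul_assoc cocycle[OF k(1,4)] cocycle[OF k(2,5)] cocycle[OF k(3,6)])
next
  fix x assume "x \<in> carrier Tri"
  then obtain c k1 k2 k3 where x: "x = (c, k1, k2, k3)"
    and k: "k1 \<in> affs False" "k2 \<in> affs False" "k3 \<in> affs True" by auto
  have "(- c, ainv k1, ainv k2, ainv k3) \<in> carrier Tri"
    "(- c, ainv k1, ainv k2, ainv k3) \<otimes>\<^bsub>Tri\<^esub> x = \<one>\<^bsub>Tri\<^esub>"
    using k by (simp_all add: x ainv_closed ainv_left cocyc_ainv)
  then show "\<exists>y\<in>carrier Tri. y \<otimes>\<^bsub>Tri\<^esub> x = \<one>\<^bsub>Tri\<^esub>" by blast
  show "\<one>\<^bsub>Tri\<^esub> \<otimes>\<^bsub>Tri\<^esub> x = x" by (simp add: x)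
next
  fix x y assume "x \<in> carrier Tri" "y \<in> carrier Tri"
  then show "x \<otimes>\<^bsub>Tri\<^esub> y \<in> carrier Tri"
    unfolding Tri_simps(1) by (elim SigmaE) (simp only: Tri_simps SigmaI UNIV_I amul_closed)
qed simp

text \<open>The argument runs in any isomorphic copy of \<open>Tri\<close>, as the final group lives
  on natural numbers.\<close>

locale Tri_model = group G for G (structure) +
  fixes inc :: "f11 \<times> aff \<times> aff \<times> aff \<Rightarrow> 'a"
  assumes inc_iso: "inc \<in> iso Tri G"
begin

definition "j1 = (\<lambda>(c, k). inc (c, k, aone, aone))"
definition "j2 = (\<lambda>(c, k). inc (c, aone, k, aone))"
definition "j3 = (\<lambda>(c, k). inc (c, aone, aone, k))"

definition "Q1 = j1 ` carrier (Heis 1 False)"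
definition "Q2 = j2 ` carrier (Heis (-1) False)"
definition "Q3 = j3 ` carrier (Heis 1 True)"

lemma inc_mult: "x \<in> carrier Tri \<Longrightarrow> y \<in> carrier Tri \<Longrightarrow> inc x \<otimes> inc y = inc (x \<otimes>\<^bsub>Tri\<^esub> y)"
  by (rule hom_mult[symmetric]) (use inc_iso in \<open>simp_all only: iso_def mem_Collect_eq\<close>)

lemma inc_inj: "inj_on inc (carrier Tri)" and inc_surj: "inc ` carrier Tri = carrier G"
  using inc_iso by (simp_all add: iso_def bij_betw_def)

lemma inc_closed: "x \<in> carrier Tri \<Longrightarrow> inc x \<in> carrier G"
  using inc_surj by blast

lemma inc_eq_iff: "x \<in> carrier Tri \<Longrightarrow> y \<in> carrier Tri \<Longrightarrow> inc x = inc y \<longleftrightarrow> x = y"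
  using inc_inj by (simp only: inj_on_eq_iff)

lemma mem_Q:
  "x \<in> Q1 \<longleftrightarrow> (\<exists>c. \<exists>k \<in> affs False. x = inc (c, k, aone, aone))"
  "x \<in> Q2 \<longleftrightarrow> (\<exists>c. \<exists>k \<in> affs False. x = inc (c, aone, k, aone))"
  "x \<in> Q3 \<longleftrightarrow> (\<exists>c. \<exists>k \<in> affs True. x = inc (c, aone, aone, k))"
  unfolding Q1_def Q2_def Q3_def j1_def j2_def j3_def Heis_simps by (auto simp only: image_iff split: prod.splits)

lemma j_hom:
  "j1 \<in> hom (Heis 1 False) G" "j2 \<in> hom (Heis (-1) False) G" "j3 \<in> hom (Heis 1 True) G"
  unfolding hom_def j1_def j2_def j3_def
  by (auto simp: inc_closed inc_mult simp del: split_paired_All)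

lemma j_inj:
  "inj_on j1 (carrier (Heis 1 False))" "inj_on j2 (carrier (Heis (-1) False))"
  "inj_on j3 (carrier (Heis 1 True))"
  by (auto simp: inj_on_def j1_def j2_def j3_def inc_eq_iff)

lemma j_iso:
  "j1 \<in> iso (Heis 1 False) (G\<lparr>carrier := Q1\<rparr>)"
  "j2 \<in> iso (Heis (-1) False) (G\<lparr>carrier := Q2\<rparr>)"
  "j3 \<in> iso (Heis 1 True) (G\<lparr>carrier := Q3\<rparr>)"
  unfolding Q1_def Q2_def Q3_def by (intro hom_iso_image j_hom j_inj)+

lemma Q_subgroup: "subgroup Q1 G" "subgroup Q2 G" "subgroup Q3 G"
  unfolding Q1_def Q2_def Q3_def
  by (intro group_hom.img_is_subgroup group_hom.intro group_hom_axioms.intro group_Heis is_group j_hom)+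

lemma Q_group: "group (G\<lparr>carrier := Q1\<rparr>)" "group (G\<lparr>carrier := Q2\<rparr>)" "group (G\<lparr>carrier := Q3\<rparr>)"
  using Q_subgroup subgroup.subgroup_is_group is_group by blast+

lemma Q_indecomposable:
  "Q \<in> {Q1, Q2, Q3} \<Longrightarrow> centrally_indecomposable (G\<lparr>carrier := Q\<rparr>)"
  using iso_centrally_indecomposable[OF j_iso(1) Heis_indecomposable Q_group(1)]
    iso_centrally_indecomposable[OF j_iso(2) Heis_indecomposable Q_group(2)]
    iso_centrally_indecomposable[OF j_iso(3) Heis_indecomposable Q_group(3)]
  by auto

lemma finite_carrier: "finite (carrier G)"
  unfolding inc_surj[symmetric] by simp

lemma inc_split:
  assumes "k1 \<in> affs False" "k2 \<in> affs False" "k3 \<in> affs True"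
  shows "inc (0, aone, k2, k3) = inc (0, aone, k2, aone) \<otimes> inc (0, aone, aone, k3)"
    "inc (c, k1, k2, k3) = inc (c, k1, aone, aone) \<otimes> inc (0, aone, k2, k3)"
  using assms by (simp_all add: inc_mult)

lemma Q_central_product: "central_product G [Q1, Q2, Q3]"
  unfolding central_product_triple_iff
proof (intro conjI ballI)
  show "group G" by (rule is_group)
  show "carrier G = Q1 <#> (Q2 <#> Q3)"
  proof
    show "carrier G \<subseteq> Q1 <#> (Q2 <#> Q3)"
    proof
      fix x assume "x \<in> carrier G"
      then obtain c k1 k2 k3 where x: "x = inc (c, k1, k2, k3)"
        and k: "k1 \<in> affs False" "k2 \<in> affs False" "k3 \<in> affs True"
        unfolding inc_surj[symmetric] by (auto simp only: image_iff Tri_simps mem_Times_iff split: prod.splits)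
      have "inc (c, k1, aone, aone) \<in> Q1" "inc (0, aone, k2, aone) \<in> Q2" "inc (0, aone, aone, k3) \<in> Q3"
        using k unfolding mem_Q by blast+
      then show "x \<in> Q1 <#> (Q2 <#> Q3)"
        unfolding x inc_split(2)[OF k] inc_split(1)[OF k] set_mult_def by blast
    qed
    show "Q1 <#> (Q2 <#> Q3) \<subseteq> carrier G"
      using Q_subgroup by (intro setmult_subset_G subgroup.subset)
  qed
qed (use Q_subgroup in \<open>auto simp only: mem_Q inc_mult Tri_simps SigmaI UNIV_I aone_closed
  amul_aone cocyc_aone add.commute add_0_left add_0_right diff_0_right\<close>)

section \<open>How automorphisms permute the three factors\<close>

lemma Q_finite: "finite Q1" "finite Q2" "finite Q3"
  using finite_carrier Q_subgroup subgroup.subset finite_subset by blast+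

text \<open>\<open>Q3\<close> is larger because it contains the second module as well; this singles
  it out among the factors.\<close>

lemma card_Q: "card Q1 = card Q2" "card Q1 < card Q3"
proof -
  have fin: "finite (affs b)" for b by (rule finite_subset[OF subset_UNIV]) simp
  have c: "card Q1 = card (UNIV :: f11 set) * card (affs False)"
    "card Q2 = card (UNIV :: f11 set) * card (affs False)"
    "card Q3 = card (UNIV :: f11 set) * card (affs True)"
    unfolding Q1_def Q2_def Q3_def
    using card_image[OF j_inj(1)] card_image[OF j_inj(2)] card_image[OF j_inj(3)]
    by (simp_all add: card_cartesian_product)
  show "card Q1 = card Q2" by (simp add: c)
  have "(mat_one, 0, (1, 0)) \<in> affs True" "(mat_one, 0, (1, 0)) \<notin> affs False"
    by (simp_all add: mat_one_icos zero_prod_def)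
  moreover have "affs False \<subseteq> affs True" by (auto simp: affs_def)
  ultimately have "affs False \<subset> affs True" by blast
  then have "card (affs False) < card (affs True)" by (rule psubset_card_mono[OF fin])
  moreover have "card (UNIV :: f11 set) > 0" by (simp add: card_gt_0_iff)
  ultimately show "card Q1 < card Q3" by (simp add: c)
qed

lemma Q_not_subset: "\<not> Q1 \<subseteq> Q2" "\<not> Q1 \<subseteq> Q3" "\<not> Q2 \<subseteq> Q3"
proof -
  \<comment> \<open>Any element of \<open>affs False\<close> other than \<open>aone\<close> would
    separate the factors, which meet pairwise only in the common center.\<close>
  let ?k = "(mat_neg_one, 0, 0) :: aff"
  have k: "?k \<in> affs False" "?k \<noteq> aone"
    using mat_one_neq_mat_neg_one by (simp_all add: mat_neg_one_icos aone_def)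
  have 1: "inc (0, ?k, aone, aone) \<in> Q1" and 2: "inc (0, aone, ?k, aone) \<in> Q2"
    unfolding mem_Q using k(1) by blast+
  have "inc (0, ?k, aone, aone) \<notin> Q2" "inc (0, ?k, aone, aone) \<notin> Q3"
    "inc (0, aone, ?k, aone) \<notin> Q3"
    unfolding mem_Q using k by (auto simp: inc_eq_iff simp del: affs_iff)
  then show "\<not> Q1 \<subseteq> Q2" "\<not> Q1 \<subseteq> Q3" "\<not> Q2 \<subseteq> Q3" using 1 2 by blast+
qed

text \<open>Pulled back along \<open>j\<close> and \<open>j'\<close>, the restriction to
  \<open>Q\<close> becomes an isomorphism between extensions, to which
  \<open>Heis_iso_multiplier\<close> applies. Both centers are the same subgroup under
  \<open>inc\<close>, so multipliers found on different factors can be compared.\<close>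

lemma auto_multiplier:
  assumes phi: "\<phi> \<in> auto G"
    and Q: "Q \<subseteq> carrier G" "\<phi> ` Q = Q'"
    and j: "j \<in> iso (Heis e b) (G\<lparr>carrier := Q\<rparr>)" and j': "j' \<in> iso (Heis e' b') (G\<lparr>carrier := Q'\<rparr>)"
    and e: "e \<noteq> 0" "e' \<noteq> 0"
    and center: "\<And>c. j (c, aone) = inc (c, aone, aone, aone)" "\<And>c. j' (c, aone) = inc (c, aone, aone, aone)"
  shows "\<exists>\<mu> t. t \<noteq> 0 \<and> e * \<mu> = e' * (t * t) \<and>
    (\<forall>c. \<phi> (inc (c, aone, aone, aone)) = inc (c * \<mu>, aone, aone, aone))"
proof -
  have phi_iso: "\<phi> \<in> iso (G\<lparr>carrier := Q\<rparr>) (G\<lparr>carrier := Q'\<rparr>)"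
    using auto_iso_restrict[OF phi Q(1)] Q(2) by simp
  have bij': "bij_betw j' (carrier (Heis e' b')) Q'" using j' by (simp add: iso_def)
  define th where "th = inv_into (carrier (Heis e' b')) j' \<circ> (\<phi> \<circ> j)"
  have "th \<in> iso (Heis e b) (Heis e' b')"
    unfolding th_def
    by (intro iso_set_trans[OF iso_set_trans[OF j phi_iso]] group.iso_set_sym group_Heis j')
  from Heis_iso_multiplier[OF e this]
  obtain \<mu> t where mt: "t \<noteq> 0" "e * \<mu> = e' * (t * t)" "\<And>c. th (c, aone) = (c * \<mu>, aone)"
    by blast
  have "\<phi> (inc (c, aone, aone, aone)) = inc (c * \<mu>, aone, aone, aone)" for c
  proof -
    have "j (c, aone) \<in> Q" using j hom_in_carrier[of j "Heis e b" "G\<lparr>carrier := Q\<rparr>" "(c, aone)"]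
      by (simp add: iso_def)
    then have "\<phi> (j (c, aone)) \<in> j' ` carrier (Heis e' b')"
      using Q(2) bij' unfolding bij_betw_def by blast
    then have "j' (th (c, aone)) = \<phi> (j (c, aone))"
      unfolding th_def comp_def by (rule f_inv_into_f)
    then show ?thesis by (simp add: mt(3) center)
  qed
  then show ?thesis using mt by blast
qed

lemma j_center:
  "j1 (c, aone) = inc (c, aone, aone, aone)" "j2 (c, aone) = inc (c, aone, aone, aone)"
  "j3 (c, aone) = inc (c, aone, aone, aone)"
  by (simp_all add: j1_def j2_def j3_def)

text \<open>
  An automorphism that preserves \<open>Q3\<close> multiplies the common center by a nonzero square, one that maps \<open>Q1\<close>
  to \<open>Q2\<close> by the negative of a square.
\<close>

lemma auto_not_swap:
  assumes phi: "\<phi> \<in> auto G" and 3: "\<phi> ` Q3 = Q3" shows "\<phi> ` Q1 \<noteq> Q2"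
proof
  assume 1: "\<phi> ` Q1 = Q2"
  obtain \<mu> t where t: "t \<noteq> 0" "1 * \<mu> = -1 * (t * t)"
    "\<And>c. \<phi> (inc (c, aone, aone, aone)) = inc (c * \<mu>, aone, aone, aone)"
    using auto_multiplier[OF phi subgroup.subset[OF Q_subgroup(1)] 1 j_iso(1,2) _ _ j_center(1,2)]
    by auto
  obtain \<nu> s where s: "s \<noteq> 0" "1 * \<nu> = 1 * (s * s)"
    "\<And>c. \<phi> (inc (c, aone, aone, aone)) = inc (c * \<nu>, aone, aone, aone)"
    using auto_multiplier[OF phi subgroup.subset[OF Q_subgroup(3)] 3 j_iso(3,3) _ _ j_center(3,3)]
    by auto
  have "inc (1 * \<mu>, aone, aone, aone) = inc (1 * \<nu>, aone, aone, aone)"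
    using t(3)[of 1] s(3)[of 1] by (rule trans[OF sym])
  then have "1 * \<mu> = 1 * \<nu>" by (simp add: inc_eq_iff)
  then have "s * s = - (t * t)" using t(2) s(2) by simp
  then show False using f11_not_neg_square s(1) by blast
qed

text \<open>The image of a factor is again an indecomposable factor of a central product
  decomposition, so it lies in one of the three.\<close>

lemma auto_image_cases:
  assumes phi: "\<phi> \<in> auto G" and Q: "Q \<in> {Q1, Q2, Q3}"
  shows "\<phi> ` Q \<subseteq> Q1 \<or> \<phi> ` Q \<subseteq> Q2 \<or> \<phi> ` Q \<subseteq> Q3"
proof -
  have "\<exists>C. central_product G [Q, C]"
    using Q central_product_triple_imp_pair[OF Q_central_product]
      central_product_triple_imp_pair[OF central_product_swap(1)[OF Q_central_product]]
      central_product_triple_imp_pair[OF central_product_swap(1)[OF central_product_swap(2)[OF Q_central_product]]]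
    by blast
  then obtain C where C: "central_product G [Q, C]" by blast
  then have PC: "central_product G [\<phi> ` Q, \<phi> ` C]" by (rule auto_central_product[OF phi])
  have sQ: "Q \<subseteq> carrier G" using C subgroup.subset unfolding central_product_pair_iff by blast
  have "group (G\<lparr>carrier := \<phi> ` Q\<rparr>)"
    using PC subgroup.subgroup_is_group is_group unfolding central_product_pair_iff by blast
  then have "centrally_indecomposable (G\<lparr>carrier := \<phi> ` Q\<rparr>)"
    by (rule iso_centrally_indecomposable[OF auto_iso_restrict[OF phi sQ] Q_indecomposable[OF Q]])
  then show ?thesis by (rule indecomposable_triple_cases[OF Q_central_product PC])
qed

lemma Q_characteristic:
  assumes Q: "Q \<in> {Q1, Q2, Q3}"
  shows "characteristic_subgroup Q G"
proof -
  have "\<phi> ` Q = Q" if phi: "\<phi> \<in> auto G" for \<phi>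
  proof -
    have inj: "inj_on \<phi> (carrier G)" using phi by (auto simp: auto_def Bij_def bij_betw_def)
    note sub = Q_subgroup[THEN subgroup.subset]
    have card: "card (\<phi> ` Q1) = card Q1" "card (\<phi> ` Q2) = card Q1" "card (\<phi> ` Q3) = card Q3"
      using card_image[OF inj_on_subset[OF inj sub(1)]] card_image[OF inj_on_subset[OF inj sub(2)]]
        card_image[OF inj_on_subset[OF inj sub(3)]] card_Q(1) by simp_all
    \<comment> \<open>The image of \<open>Q3\<close> is too large for the other two factors.\<close>
    have "\<not> \<phi> ` Q3 \<subseteq> Q1" "\<not> \<phi> ` Q3 \<subseteq> Q2"
      using card_mono[OF Q_finite(1), of "\<phi> ` Q3"] card_mono[OF Q_finite(2), of "\<phi> ` Q3"]
      unfolding card(3) card_Q(1)[symmetric] using card_Q(2) by linarith+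
    then have "\<phi> ` Q3 \<subseteq> Q3"
      using auto_image_cases[OF phi, of Q3] by blast
    then have 3: "\<phi> ` Q3 = Q3" using card_subset_eq[OF Q_finite(3)] card by blast
    \<comment> \<open>Since \<open>Q3\<close> is mapped onto itself, injectivity keeps elements
      outside \<open>Q3\<close> outside it. So the images of \<open>Q1\<close> and \<open>Q2\<close>
      lie in those two factors.\<close>
    have n3: "\<not> \<phi> ` P \<subseteq> Q3" if P: "P \<subseteq> carrier G" "\<not> P \<subseteq> Q3" for P
    proof -
      obtain x where x: "x \<in> P" "x \<notin> Q3" using P(2) by blast
      then have "\<phi> x \<notin> \<phi> ` Q3"
        using inj_on_image_mem_iff[OF inj _ sub(3)] P(1) by blast
      then show ?thesis unfolding 3 using x(1) by blast
    qed
    have "\<phi> ` Q1 \<subseteq> Q1 \<or> \<phi> ` Q1 \<subseteq> Q2"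
      using auto_image_cases[OF phi, of Q1] n3[OF sub(1) Q_not_subset(2)] by blast
    then have "\<phi> ` Q1 = Q1 \<or> \<phi> ` Q1 = Q2"
      using card_subset_eq[OF Q_finite(1)] card_subset_eq[OF Q_finite(2)] card card_Q(1) by metis
    then have 1: "\<phi> ` Q1 = Q1" using auto_not_swap[OF phi 3] by blast
    have "\<phi> ` Q2 \<subseteq> Q1 \<or> \<phi> ` Q2 \<subseteq> Q2"
      using auto_image_cases[OF phi, of Q2] n3[OF sub(2) Q_not_subset(3)] by blast
    then have "\<phi> ` Q2 = Q1 \<or> \<phi> ` Q2 = Q2"
      using card_subset_eq[OF Q_finite(1)] card_subset_eq[OF Q_finite(2)] card card_Q(1) by metis
    moreover have "\<phi> ` Q2 \<noteq> \<phi> ` Q1"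
      using inj_on_image_eq_iff[OF inj sub(2,1)] Q_not_subset(1) by blast
    ultimately have "\<phi> ` Q2 = Q2" using 1 by simp
    then show ?thesis using Q 1 3 by blast
  qed
  then show ?thesis unfolding characteristic_subgroup_def using Q Q_subgroup by blast
qed

text \<open>
  In \<open>opp\<close>, inversion in \<open>Q1\<close> turns the opposite of \<open>Heis 1 False\<close> into \<open>Heis (-1) False\<close>. This accounts for
  the inverses in \<open>swap\<close>.
\<close>

definition "opp = replace_by_opposite G Q1 (Q2 <#> Q3)"

lemma opp_mult:
  assumes k: "k1 \<in> affs False" "k2 \<in> affs False" "k3 \<in> affs True"
    and l: "l1 \<in> affs False" "l2 \<in> affs False" "l3 \<in> affs True"
  shows "inc (c, k1, k2, k3) \<otimes>\<^bsub>opp\<^esub> inc (d, l1, l2, l3) =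
    inc (c + d + cocyc l1 k1 - cocyc k2 l2 + cocyc k3 l3, amul l1 k1, amul k2 l2, amul k3 l3)"
proof -
  have Q: "inc (c, k1, aone, aone) \<in> Q1" "inc (d, l1, aone, aone) \<in> Q1"
    unfolding mem_Q using k l by blast+
  have "inc (0, aone, k2, aone) \<in> Q2" "inc (0, aone, l2, aone) \<in> Q2"
    "inc (0, aone, aone, k3) \<in> Q3" "inc (0, aone, aone, l3) \<in> Q3"
    unfolding mem_Q using k l by blast+
  then have R: "inc (0, aone, k2, k3) \<in> Q2 <#> Q3" "inc (0, aone, l2, l3) \<in> Q2 <#> Q3"
    unfolding inc_split(1)[OF k] inc_split(1)[OF l] set_mult_def by blast+
  show ?thesis
    unfolding inc_split(2)[OF k] inc_split(2)[OF l] opp_def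
      replace_by_opposite_mult[OF central_product_triple_imp_pair[OF Q_central_product] Q R]
    using k l by (simp add: inc_mult amul_closed algebra_simps)
qed

text \<open>The map is restricted to \<open>carrier G\<close> because members of \<open>auto\<close>
  are extensional.\<close>

definition "swap = (\<lambda>x \<in> carrier G. case inv_into (carrier Tri) inc x of
  (c, k1, k2, k3) \<Rightarrow> inc (c, ainv k2, ainv k1, k3))"

lemma swap_inc:
  assumes k: "k1 \<in> affs False" "k2 \<in> affs False" "k3 \<in> affs True"
  shows "swap (inc (c, k1, k2, k3)) = inc (c, ainv k2, ainv k1, k3)"
proof -
  have "(c, k1, k2, k3) \<in> carrier Tri" using k by simp
  then show ?thesis
    unfolding swap_def by (simp only: restrict_apply' inc_closed inv_into_f_f[OF inc_inj] prod.case)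
qed

lemma carrier_cases:
  assumes "x \<in> carrier G"
  obtains c k1 k2 k3 where "x = inc (c, k1, k2, k3)" "k1 \<in> affs False" "k2 \<in> affs False" "k3 \<in> affs True"
  using assms unfolding inc_surj[symmetric] by (auto simp only: image_iff Tri_simps mem_Times_iff split: prod.splits)

lemma swap_closed: "x \<in> carrier G \<Longrightarrow> swap x \<in> carrier G"
  by (erule carrier_cases) (simp add: swap_inc inc_closed ainv_closed)

lemma swap_swap: "x \<in> carrier G \<Longrightarrow> swap (swap x) = x"
  by (erule carrier_cases) (simp add: swap_inc ainv_closed ainv_ainv)

text \<open>In \<open>opp\<close> the first cocycle has its arguments exchanged. By
  \<open>cocyc_ainv_ainv\<close>, inversion turns it into the negated cocycle carried by the second
  factor, and conversely.\<close>

lemma swap_auto: "swap \<in> auto opp"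
proof -
  have car: "carrier opp = carrier G" by (simp add: opp_def)
  have "swap (x \<otimes>\<^bsub>opp\<^esub> y) = swap x \<otimes>\<^bsub>opp\<^esub> swap y" if "x \<in> carrier G" "y \<in> carrier G" for x y
    using that
    by (elim carrier_cases)
      (simp add: opp_mult swap_inc ainv_closed amul_closed ainv_amul cocyc_ainv_ainv algebra_simps)
  then have "swap \<in> hom opp opp" by (simp add: hom_def car swap_closed)
  moreover have "bij_betw swap (carrier G) (carrier G)"
    by (rule bij_betw_byWitness[of _ swap]) (use swap_closed swap_swap in auto)
  ultimately show ?thesis by (simp add: auto_def Bij_def car swap_def)
qed

lemma swap_Q: "swap ` Q1 = Q2" "swap ` Q2 = Q1"
proof -
  have 1: "swap ` Q1 \<subseteq> Q2"
  proof (rule image_subsetI)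
    fix x assume "x \<in> Q1"
    then obtain c k where k: "k \<in> affs False" "x = inc (c, k, aone, aone)" unfolding mem_Q by blast
    have "swap x = inc (c, aone, ainv k, aone)"
      unfolding k(2) swap_inc[OF k(1) aone_closed aone_closed] ainv_aone ..
    then show "swap x \<in> Q2"
      unfolding mem_Q using ainv_closed[OF k(1)] by blast
  qed
  have 2: "swap ` Q2 \<subseteq> Q1"
  proof (rule image_subsetI)
    fix x assume "x \<in> Q2"
    then obtain c k where k: "k \<in> affs False" "x = inc (c, aone, k, aone)" unfolding mem_Q by blast
    have "swap x = inc (c, ainv k, aone, aone)"
      unfolding k(2) swap_inc[OF aone_closed k(1) aone_closed] ainv_aone ..
    then show "swap x \<in> Q1"
      unfolding mem_Q using ainv_closed[OF k(1)] by blast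
  qed
  have invol: "swap ` swap ` Q = Q" if "Q \<subseteq> carrier G" for Q
    unfolding image_image using swap_swap that by (simp add: subset_iff)
  have "Q2 \<subseteq> swap ` Q1"
    using image_mono[OF 2, of swap] unfolding invol[OF subgroup.subset[OF Q_subgroup(2)]] .
  then show "swap ` Q1 = Q2" using 1 by (rule subset_antisym[rotated])
  have "Q1 \<subseteq> swap ` Q2"
    using image_mono[OF 1, of swap] unfolding invol[OF subgroup.subset[OF Q_subgroup(1)]] .
  then show "swap ` Q2 = Q1" using 2 by (rule subset_antisym[rotated])
qed

lemma Tri_model_properties:
  "finite (carrier G)" "central_product G [Q1, Q2, Q3]"
  "\<forall>Q \<in> {Q1, Q2, Q3}. finite Q \<and> perfect_group (G\<lparr>carrier := Q\<rparr>) \<and>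
     centrally_indecomposable (G\<lparr>carrier := Q\<rparr>)"
  "\<forall>Q \<in> {Q1, Q2, Q3}. characteristic_subgroup Q G"
  "swap \<in> auto (replace_by_opposite G Q1 (Q2 <#> Q3))"
  "swap ` Q1 = Q2" "swap ` Q2 = Q1" "Q1 \<noteq> Q2"
proof -
  have "perfect_group (G\<lparr>carrier := Q\<rparr>)" if "Q \<in> {Q1, Q2, Q3}" for Q
    using Q_indecomposable[OF that] by (simp add: centrally_indecomposable_def)
  then show "\<forall>Q \<in> {Q1, Q2, Q3}. finite Q \<and> perfect_group (G\<lparr>carrier := Q\<rparr>) \<and>
     centrally_indecomposable (G\<lparr>carrier := Q\<rparr>)"
    using Q_finite Q_indecomposable by blast
qed (use finite_carrier Q_central_product Q_characteristic swap_auto opp_def swap_Q Q_not_subset in auto)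

end

theorem proposition7p9:
  shows "\<exists>(G :: nat monoid) Q1 Q2 Q3.
    finite (carrier G) \<and>
    central_product G [Q1, Q2, Q3] \<and>
    (\<forall>Q \<in> {Q1, Q2, Q3}.
       finite Q \<and> perfect_group (G\<lparr>carrier := Q\<rparr>) \<and> centrally_indecomposable (G\<lparr>carrier := Q\<rparr>)) \<and>
    (\<forall>Q \<in> {Q1, Q2, Q3}. characteristic_subgroup Q G) \<and>
    (let G' = replace_by_opposite G Q1 (Q2 <#>\<^bsub>G\<^esub> Q3) in
       (\<exists>\<phi> \<in> auto G'. \<phi> ` Q1 = Q2 \<and> \<phi> ` Q2 = Q1) \<and>
       \<not> characteristic_subgroup Q1 G' \<and>
       \<not> characteristic_subgroup Q2 G')"
proof -
  \<comment> \<open>The underlying type of \<open>Tri\<close> is finite, so it embeds into the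
    natural numbers.\<close>
  obtain f :: "f11 \<times> aff \<times> aff \<times> aff \<Rightarrow> nat" where "inj f"
    using finite_imp_inj_to_nat_seg[OF finite_UNIV] by metis
  then have "inj_on f (carrier Tri)" by (rule inj_on_subset) simp
  from group.inj_image_group[OF group_Tri this]
  obtain G :: "nat monoid" where "group G" "f \<in> iso Tri G" by blast
  then interpret Tri_model G f
    by (intro Tri_model.intro Tri_model_axioms.intro)
  let ?G' = "replace_by_opposite G Q1 (Q2 <#>\<^bsub>G\<^esub> Q3)"
  \<comment> \<open>\<open>swap\<close> moves each of the distinct subgroups \<open>Q1\<close> and
    \<open>Q2\<close> onto the other.\<close>
  have not_char: "\<not> characteristic_subgroup Q1 ?G'" "\<not> characteristic_subgroup Q2 ?G'"
    using Tri_model_properties(5-8) unfolding characteristic_subgroup_def by auto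
  show ?thesis
    unfolding Let_def
    by (rule exI[of _ G], rule exI[of _ Q1], rule exI[of _ Q2], rule exI[of _ Q3],
        intro conjI bexI[of _ swap]) (fact Tri_model_properties not_char)+
qed

end
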